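(* Let $N>1$ and let $\mathcal{M}_N^e=\{\nu\in\mathcal{M}_N\mid\nu(-E)=\nu(E),\ E\text{ Borel}\}$. If $\mu$ is a Siegel measure on $\mathcal{M}_N^e$, and if $T_\lambda\nu=\nu$ for all $\lambda>0$, for $\mu$-a.e. $\nu\in\mathcal{M}_N^e$, then $\mu$ is the point mass at the measure $c(\mu)\,dx$, where $dx$ is Lebesgue measure on $\mathbf{R}^N$.
   Context: $\mathcal{M}_N$ is the set of Borel measures $\nu$ on $\mathbf{R}^N$ with $\sup_{R>0}\nu(B(0,R))/R^N<\infty$, where $B(0,R)$ is the open ball of radius $R$ about $0$, endowed with the $C_c(\mathbf{R}^N)$ weak-$*$ topology and its Borel $\sigma$-algebra. $\mathrm{SL}(N,\mathbf{R})$ acts on $\mathcal{M}_N$ by $(g\nu)(E)=\nu(g^{-1}E)$. A Siegel measure is a Borel probability measure on $\mathcal{M}_N$ invariant and ergodic for this action; "on $\mathcal{M}_N^e$" means supported on $\mathcal{M}_N^e$. For a Siegel measure $\mu$, $c(\mu)<\infty$ denotes the constant (which exists for every Siegel measure) such that $\int_{\mathcal{M}_N}\left(\int_{\mathbf{R}^N}\psi\,d\nu\right)\mu(d\nu)=c(\mu)\int_{\mathbf{R}^N}\psi(x)\,dx$ for all Borel $\psi\in L^1(\mathbf{R}^N,dx)$. For $\lambda>0$, $T_\lambda\nu(E)=\nu(\lambda E)/\lambda^N$ for Borel sets $E$. *)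

theory Defs
  imports "HOL-Probability.Probability"
begin

definition growth_measures :: "(real ^ 'n) measure set" where
  "growth_measures = {\<nu>. sets \<nu> = sets borel \<and>
     (SUP R\<in>{0<..}. emeasure \<nu> (ball 0 R) / ennreal (R ^ CARD('n))) < \<infinity>}"

definition even_growth_measures :: "(real ^ 'n) measure set" where
  "even_growth_measures = {\<nu> \<in> growth_measures.
     \<forall>E \<in> sets borel. emeasure \<nu> (uminus ` E) = emeasure \<nu> E}"

definition compactly_supported_continuous :: "(real ^ 'n \<Rightarrow> real) set" where
  "compactly_supported_continuous =
     {\<psi>. continuous_on UNIV \<psi> \<and> compact (closure {x. \<psi> x \<noteq> 0})}"

definition weak_star_topology :: "(real ^ 'n) measure topology" where
  "weak_star_topology = topology_generated_by
     {{\<nu> \<in> growth_measures. (\<integral>x. \<psi> x \<partial>\<nu>) \<in> U} | \<psi> U.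
        \<psi> \<in> compactly_supported_continuous \<and> open U}"

lemma topspace_weak_star_topology: "topspace weak_star_topology = growth_measures"
proof -
  have "(\<lambda>x::real^'n. 0::real) \<in> compactly_supported_continuous"
    by (simp add: compactly_supported_continuous_def)
  then have "\<exists>\<psi> U. growth_measures = {\<nu> \<in> growth_measures. (\<integral>x. \<psi> x \<partial>\<nu>) \<in> U}
      \<and> \<psi> \<in> compactly_supported_continuous \<and> open (U :: real set)"
    by (intro exI[of _ "\<lambda>x::real^'n. 0::real"] exI[of _ UNIV]) auto
  then show ?thesis
    unfolding weak_star_topology_def topology_generated_by_topspace by blast
qed

definition growth_measures_borel :: "(real ^ 'n) measure measure" where
  "growth_measures_borel = sigma growth_measures {U. openin weak_star_topology U}"

lemma space_growth_measures_borel: "space growth_measures_borel = growth_measures"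
  by (simp add: growth_measures_borel_def space_measure_of_conv)

lemma sets_growth_measures_borel:
  "sets growth_measures_borel = sigma_sets growth_measures {U. openin weak_star_topology U}"
  unfolding growth_measures_borel_def
  by (rule sets_measure_of) (use openin_subset topspace_weak_star_topology in blast)

definition SL :: "(real ^ 'n ^ 'n) set" where
  "SL = {g. det g = 1}"

definition SL_act :: "real ^ 'n ^ 'n \<Rightarrow> (real ^ 'n) measure \<Rightarrow> (real ^ 'n) measure" where
  "SL_act g \<nu> = distr \<nu> borel (\<lambda>x. g *v x)"

lemma emeasure_SL_act:
  fixes g :: "real ^ 'n ^ 'n"
  assumes "g \<in> SL" "sets \<nu> = sets borel" "E \<in> sets borel"
  shows "emeasure (SL_act g \<nu>) E = emeasure \<nu> ((\<lambda>x. matrix_inv g *v x) ` E)"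
proof -
  have "invertible g"
    using assms(1) by (simp add: SL_def invertible_det_nz)
  then have inv: "g ** matrix_inv g = mat 1" "matrix_inv g ** g = mat 1"
    unfolding matrix_inv_def invertible_def by (metis (mono_tags, lifting) someI_ex)+
  have "(\<lambda>x. matrix_inv g *v x) ` E = (\<lambda>x. g *v x) -` E"
  proof (intro set_eqI iffI)
    fix y assume "y \<in> (\<lambda>x. matrix_inv g *v x) ` E"
    then show "y \<in> (\<lambda>x. g *v x) -` E"
      using inv(1) by (auto simp: matrix_vector_mul_assoc)
  next
    fix y assume "y \<in> (\<lambda>x. g *v x) -` E"
    then show "y \<in> (\<lambda>x. matrix_inv g *v x) ` E"
      using inv(2)
      by (intro image_eqI[of _ _ "g *v y"]) (auto simp: matrix_vector_mul_assoc)
  qed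
  moreover have "(\<lambda>x. g *v x) \<in> borel_measurable \<nu>"
    using assms(2)
    by (simp add: measurable_cong_sets[OF assms(2) refl] borel_measurable_continuous_onI
        matrix_vector_mult_linear_continuous_on)
  moreover have "space \<nu> = UNIV"
    using sets_eq_imp_space_eq[OF assms(2)] by simp
  ultimately show ?thesis
    using assms(3) by (simp add: SL_act_def emeasure_distr)
qed

definition dilate :: "real \<Rightarrow> (real ^ 'n) measure \<Rightarrow> (real ^ 'n) measure" where
  "dilate r \<nu> = scale_measure (1 / ennreal (r ^ CARD('n))) (distr \<nu> borel (\<lambda>x. x /\<^sub>R r))"

lemma emeasure_dilate:
  fixes \<nu> :: "(real ^ 'n) measure"
  assumes "r > 0" "sets \<nu> = sets borel" "E \<in> sets borel"
  shows "emeasure (dilate r \<nu>) E = emeasure \<nu> ((\<lambda>x. r *\<^sub>R x) ` E) / ennreal (r ^ CARD('n))"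
proof -
  have "(\<lambda>x. r *\<^sub>R x) ` E = (\<lambda>x. x /\<^sub>R r) -` E"
  proof (intro set_eqI iffI)
    fix y assume "y \<in> (\<lambda>x. x /\<^sub>R r) -` E"
    then show "y \<in> (\<lambda>x. r *\<^sub>R x) ` E"
      using assms(1) by (intro image_eqI[of _ _ "y /\<^sub>R r"]) auto
  qed (use assms(1) in auto)
  moreover have "(\<lambda>x. x /\<^sub>R r) \<in> borel_measurable \<nu>"
    by (simp add: measurable_cong_sets[OF assms(2) refl])
  moreover have "space \<nu> = UNIV"
    using sets_eq_imp_space_eq[OF assms(2)] by simp
  ultimately show ?thesis
    using assms(3)
    by (simp del: real_scaleR_def inverse_eq_divide add: dilate_def emeasure_distr divide_ennreal_def mult.commute)
qed

text \<open>Ergodicity is tested on strictly invariant Borel sets.\<close>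

definition siegel_measure :: "(real ^ 'n) measure measure \<Rightarrow> bool" where
  "siegel_measure \<mu> \<longleftrightarrow>
     prob_space \<mu> \<and> sets \<mu> = sets growth_measures_borel \<and>
     (\<forall>g\<in>SL. \<forall>A\<in>sets \<mu>. emeasure \<mu> (SL_act g -` A \<inter> space \<mu>) = emeasure \<mu> A) \<and>
     (\<forall>A\<in>sets \<mu>. (\<forall>g\<in>SL. SL_act g -` A \<inter> space \<mu> = A) \<longrightarrow>
        emeasure \<mu> A = 0 \<or> emeasure \<mu> A = 1)"

text \<open>The Bochner integral is 0 on non-integrable functions, so the Siegel formula is
  stated together with the integrability it presupposes: \<open>\<psi>\<close> is \<open>\<nu>\<close>-integrable for
  almost every \<open>\<nu>\<close>, and the resulting function of \<open>\<nu>\<close> is \<open>\<mu>\<close>-integrable.\<close>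

definition siegel_formula :: "(real ^ 'n) measure measure \<Rightarrow> real \<Rightarrow> bool" where
  "siegel_formula \<mu> c \<longleftrightarrow>
     (\<forall>\<psi>\<in>borel_measurable borel. integrable lborel \<psi> \<longrightarrow>
        (AE \<nu> in \<mu>. integrable \<nu> \<psi>) \<and>
        has_bochner_integral \<mu> (\<lambda>\<nu>. \<integral>x. \<psi> x \<partial>\<nu>) (c * (\<integral>x. \<psi> x \<partial>lborel)))"

definition siegel_constant :: "(real ^ 'n) measure measure \<Rightarrow> real" where
  "siegel_constant \<mu> = (THE c. siegel_formula \<mu> c)"

lemma siegel_formula_unique:
  fixes \<mu> :: "(real ^ 'n) measure measure"
  assumes "siegel_formula \<mu> c" "siegel_formula \<mu> d"
  shows "c = d"
proof -
  let ?\<psi> = "indicat_real (cbox 0 (1 :: real ^ 'n))"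
  have int: "integrable lborel ?\<psi>" and meas: "?\<psi> \<in> borel_measurable borel"
    using emeasure_lborel_cbox_finite[of "0 :: real ^ 'n" 1] by simp_all
  have "(\<integral>x. ?\<psi> x \<partial>lborel) = measure lborel (cbox 0 (1 :: real ^ 'n))"
    by simp
  also have "\<dots> = 1"
    by (subst content_cbox_cart) (auto simp: interval_eq_empty_cart)
  finally have one: "(\<integral>x. ?\<psi> x \<partial>lborel) = 1" .
  have "has_bochner_integral \<mu> (\<lambda>\<nu>. \<integral>x. ?\<psi> x \<partial>\<nu>) (c * 1)"
       "has_bochner_integral \<mu> (\<lambda>\<nu>. \<integral>x. ?\<psi> x \<partial>\<nu>) (d * 1)"
    using assms int meas one unfolding siegel_formula_def by metis+
  then show ?thesis
    using has_bochner_integral_eq by fastforce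
qed

end

theory Submission
  imports Defs
begin

text \<open>
  Dilation invariance leaves a measure \<open>\<nu>\<close> one degree of freedom on radial functions: such a \<open>\<nu>\<close>
  integrates them like \<open>c(\<nu>) dx\<close>, where \<open>c(\<nu>)\<close> compares the masses of the unit ball
  (\<open>homogeneous_nn_integral_radial\<close>).  The proof shows first that almost every \<open>\<nu>\<close> is \<open>c(\<nu>) dx\<close>.

  Fix \<open>\<xi>\<close> and consider the ratio \<open>r(\<nu>, \<xi>)\<close> of the integrals of \<open>exp(- |x|\<^sup>2 - (\<xi> \<bullet> x)\<^sup>2)\<close> against \<open>\<nu>\<close>
  and against \<open>dx\<close>.  Two facts force it to be constant in \<open>\<xi>\<close>.
  The quadratic form \<open>|x|\<^sup>2 + (\<xi> \<bullet> x)\<^sup>2\<close> is a positive multiple of \<open>|g x|\<^sup>2\<close> for some \<open>g\<close> in the special linear group, so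
  \<open>r(\<nu>, \<xi>) = c(g \<nu>)\<close>, and by invariance of \<open>\<mu>\<close> the law of \<open>r(\<nu>, \<xi>)\<close> under \<open>\<mu>\<close> is that of \<open>c(\<nu>)\<close>
  (\<open>gauss_integral_eq_ball_density\<close>).  On the other hand, averaging over \<open>\<xi>\<close> with a suitable
  rotation invariant weight turns the Gaussian into a radial function of \<open>x\<close>, so the mean of
  \<open>r(\<nu>, \<xi>)\<close> over \<open>\<xi>\<close> is exactly \<open>c(\<nu>)\<close>, for each single \<open>\<nu>\<close> (\<open>nn_integral_gauss_mean\<close>).
  A random variable with the same law as its own conditional expectation is equal to it: this is
  the equality case of Jensen's inequality for a strictly convex function
  (\<open>reciprocal_Jensen\<close>), and is the reason why a stationary martingale does not move.  Hence
  \<open>r(\<nu>, \<xi>) = c(\<nu>)\<close> for all \<open>\<xi>\<close> and almost all \<open>\<nu>\<close> (\<open>AE_gauss_integral_eq_ball_density\<close>).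

  Applying this to the images \<open>g \<nu>\<close> adds further squares to the exponent one at a time
  (\<open>AE_nn_integral_exp_sum_squares\<close>).  So \<open>\<nu>\<close> and \<open>c(\<nu>) dx\<close> agree, after multiplication by
  \<open>exp(- |x|\<^sup>2)\<close>, on the algebra spanned by the functions \<open>exp(- \<Sum>(x\<^sub>i + x\<^sub>j)\<^sup>2)\<close>.  These separate points
  up to sign, so by the Stone-Weierstrass theorem they determine a finite even measure
  (\<open>even_finite_measures_eq_if_square_exp_eq\<close>), and \<open>\<nu> = c(\<nu>) dx\<close> (\<open>AE_eq_scale_lborel\<close>).  Multiples
  of Lebesgue measure are fixed by the action, so ergodicity forces \<open>c(\<nu>)\<close> to be constant
  (\<open>AE_eq_const_scale_lborel\<close>), and the Siegel formula for the resulting point mass identifies the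
  constant.
\<close>

section \<open>Lebesgue measure under linear maps\<close>

lemma nn_integral_lborel_swap:
  fixes f :: "real ^ 'n \<Rightarrow> ennreal"
  assumes "f \<in> borel_measurable borel"
  shows "(\<integral>\<^sup>+x. f (\<chi> i. x $ Transposition.transpose m n i) \<partial>lborel) = (\<integral>\<^sup>+x. f x \<partial>lborel)"
proof -
  let ?T = "\<lambda>x::real^'n. \<chi> i. x $ Transposition.transpose m n i"
  have T: "?T \<in> borel_measurable borel"
    by (intro borel_measurable_continuous_onI continuous_intros continuous_on_vec_lambda)
  have "lborel = distr lborel borel ?T"
  proof (rule lborel_eqI)
    fix l u :: "real^'n"
    assume le: "\<And>b. b \<in> Basis \<Longrightarrow> l \<bullet> b \<le> u \<bullet> b"
    have le': "l $ i \<le> u $ i" for i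
      using le[of "axis i 1"] by (simp add: inner_axis axis_in_Basis_iff)
    have "?T -` box l u = box (?T l) (?T u)"
    proof (intro set_eqI)
      fix x
      have "(\<forall>i. l $ i < x $ Transposition.transpose m n i \<and> x $ Transposition.transpose m n i < u $ i)
        \<longleftrightarrow> (\<forall>i. l $ Transposition.transpose m n i < x $ i \<and> x $ i < u $ Transposition.transpose m n i)"
        by (metis Transposition.transpose_involutory)
      then show "x \<in> ?T -` box l u \<longleftrightarrow> x \<in> box (?T l) (?T u)"
        by (simp add: mem_box_cart)
    qed
    then have "emeasure (distr lborel borel ?T) (box l u) = emeasure lborel (box (?T l) (?T u))"
      using T by (simp add: emeasure_distr)
    also have "\<dots> = ennreal (\<Prod>b\<in>Basis. (?T u - ?T l) \<bullet> b)"
      by (rule emeasure_lborel_box) (auto simp: Basis_vec_def inner_axis le')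
    also have "(\<Prod>b\<in>Basis. (?T u - ?T l) \<bullet> b) = (\<Prod>i\<in>UNIV. (?T u - ?T l) $ i)"
      unfolding Basis_vec_def
      by (subst prod.UNION_disjoint) (auto simp: inner_axis axis_eq_axis)
    also have "\<dots> = (\<Prod>i\<in>UNIV. (u - l) $ (Transposition.transpose m n i))"
      by simp
    also have "\<dots> = (\<Prod>i\<in>UNIV. (u - l) $ i)"
      by (rule prod.reindex_bij_betw) (simp add: bij_transpose)
    also have "\<dots> = (\<Prod>b\<in>Basis. (u - l) \<bullet> b)"
      unfolding Basis_vec_def
      by (subst prod.UNION_disjoint) (auto simp: inner_axis axis_eq_axis)
    finally show "emeasure (distr lborel borel ?T) (box l u) = ennreal (\<Prod>b\<in>Basis. (u - l) \<bullet> b)" .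
  qed simp
  then have "(\<integral>\<^sup>+x. f x \<partial>lborel) = (\<integral>\<^sup>+x. f x \<partial>distr lborel borel ?T)" by simp
  also have "\<dots> = (\<integral>\<^sup>+x. f (?T x) \<partial>lborel)"
    using T assms by (subst nn_integral_distr) auto
  finally show ?thesis ..
qed

text \<open>Integrating first over the coordinate along \<open>b\<close>, the shear is a translation.\<close>

lemma nn_integral_lborel_shear:
  fixes f :: "'a::euclidean_space \<Rightarrow> ennreal"
  assumes f [measurable]: "f \<in> borel_measurable borel" and b: "b \<in> Basis" "c \<in> Basis" "b \<noteq> c"
  shows "(\<integral>\<^sup>+x. f (x + (x \<bullet> c) *\<^sub>R b) \<partial>lborel) = (\<integral>\<^sup>+x. f x \<partial>lborel)"
proof -
  interpret product_sigma_finite "\<lambda>_::'a. lborel :: real measure" ..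
  define I where "I = Basis - {b}"
  have I: "finite I" "b \<notin> I" "insert b I = Basis" "c \<in> I" using b by (auto simp: I_def)
  let ?S = "\<lambda>y::'a\<Rightarrow>real. \<Sum>i\<in>Basis. y i *\<^sub>R i"
  have S: "?S (y(b := s)) = s *\<^sub>R b + (\<Sum>i\<in>I. y i *\<^sub>R i)" for y s
    using I by (subst I(3)[symmetric], subst sum.insert) (auto intro!: sum.cong)
  have Sc: "?S (y(b := s)) \<bullet> c = y c" for y s
  proof -
    have "(\<Sum>i\<in>I. y i * (i \<bullet> c)) = (\<Sum>i\<in>I. if i = c then y i else 0)"
      using b by (intro sum.cong) (auto simp: I_def inner_Basis)
    then show ?thesis
      unfolding S using b I by (simp add: inner_add_left inner_sum_left inner_Basis)
  qed
  have meas: "?S \<in> borel_measurable (PiM Basis (\<lambda>_. lborel))" by simp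
  have int: "(\<integral>\<^sup>+x. g x \<partial>lborel) = (\<integral>\<^sup>+y. (\<integral>\<^sup>+s. g (?S (y(b := s))) \<partial>lborel) \<partial>PiM I (\<lambda>_. lborel))"
    if g [measurable]: "g \<in> borel_measurable borel" for g :: "'a \<Rightarrow> ennreal"
  proof -
    have "(\<integral>\<^sup>+x. g x \<partial>lborel) = (\<integral>\<^sup>+y. g (?S y) \<partial>PiM Basis (\<lambda>_. lborel))"
      by (subst lborel_eq, subst nn_integral_distr) auto
    also have "\<dots> = (\<integral>\<^sup>+y. g (?S y) \<partial>PiM (insert b I) (\<lambda>_. lborel))"
      by (simp only: I(3))
    also have "\<dots> = (\<integral>\<^sup>+y. (\<integral>\<^sup>+s. g (?S (y(b := s))) \<partial>lborel) \<partial>PiM I (\<lambda>_. lborel))"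
      by (rule product_nn_integral_insert) (use I meas in \<open>auto intro: measurable_compose\<close>)
    finally show ?thesis .
  qed
  have "(\<integral>\<^sup>+s. f (?S (y(b := s)) + (?S (y(b := s)) \<bullet> c) *\<^sub>R b) \<partial>lborel)
      = (\<integral>\<^sup>+s. f (?S (y(b := s))) \<partial>lborel)" for y
  proof -
    let ?r = "\<Sum>i\<in>I. y i *\<^sub>R i"
    have "(\<integral>\<^sup>+s. f (s *\<^sub>R b + ?r) \<partial>lborel) = (\<integral>\<^sup>+s. f ((y c + 1 * s) *\<^sub>R b + ?r) \<partial>lborel)"
      by (subst nn_integral_real_affine[where c=1 and t="y c"]) auto
    then show ?thesis
      by (simp only: Sc, simp only: S) (simp add: algebra_simps)
  qed
  then show ?thesis
    by (subst (1 2) int) auto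
qed

text \<open>The formula is multiplicative in \<open>A\<close>, so elementary matrices suffice.\<close>

lemma nn_integral_lborel_linear:
  fixes A :: "real ^ 'n ^ 'n"
  assumes "det A \<noteq> 0" "f \<in> borel_measurable borel"
  shows "ennreal \<bar>det A\<bar> * (\<integral>\<^sup>+x. f (A *v x) \<partial>lborel) = (\<integral>\<^sup>+x. f x \<partial>lborel)"
proof -
  let ?P = "\<lambda>A::real^'n^'n. det A \<noteq> 0 \<longrightarrow> (\<forall>f\<in>borel_measurable borel.
    ennreal \<bar>det A\<bar> * (\<integral>\<^sup>+x. f (A *v x) \<partial>lborel) = (\<integral>\<^sup>+x. f x \<partial>lborel))"
  have meas: "(\<lambda>x. B *v x) \<in> borel_measurable borel" for B :: "real^'n^'n"
    by (intro borel_measurable_continuous_onI matrix_vector_mult_linear_continuous_on)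
  have "?P A"
  proof (rule induct_matrix_elementary_alt[where P = ?P])
    fix A B :: "real^'n^'n"
    assume A: "?P A" and B: "?P B"
    show "?P (A ** B)"
    proof (intro impI ballI)
      fix f :: "real^'n \<Rightarrow> ennreal"
      assume d: "det (A ** B) \<noteq> 0" and f: "f \<in> borel_measurable borel"
      have "ennreal \<bar>det (A ** B)\<bar> * (\<integral>\<^sup>+x. f ((A ** B) *v x) \<partial>lborel)
          = ennreal \<bar>det A\<bar> * (ennreal \<bar>det B\<bar> * (\<integral>\<^sup>+x. f (A *v (B *v x)) \<partial>lborel))"
        by (simp add: det_mul abs_mult ennreal_mult matrix_vector_mul_assoc mult.assoc)
      also have "ennreal \<bar>det B\<bar> * (\<integral>\<^sup>+x. f (A *v (B *v x)) \<partial>lborel) = (\<integral>\<^sup>+x. f (A *v x) \<partial>lborel)"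
        using B d measurable_compose[OF meas f, of A] by (auto simp: det_mul)
      also have "ennreal \<bar>det A\<bar> * (\<integral>\<^sup>+x. f (A *v x) \<partial>lborel) = (\<integral>\<^sup>+x. f x \<partial>lborel)"
        using A d f by (auto simp: det_mul)
      finally show "ennreal \<bar>det (A ** B)\<bar> * (\<integral>\<^sup>+x. f ((A ** B) *v x) \<partial>lborel) = (\<integral>\<^sup>+x. f x \<partial>lborel)" .
    qed
  next
    fix A :: "real^'n^'n" and i
    assume "row i A = 0"
    then show "?P A" using det_zero_row(2)[of i A] by simp
  next
    fix A :: "real^'n^'n"
    assume diag: "\<And>i j. i \<noteq> j \<Longrightarrow> A $ i $ j = 0"
    show "?P A"
    proof (intro impI ballI)
      fix f :: "real^'n \<Rightarrow> ennreal"
      assume d: "det A \<noteq> 0" and f [measurable]: "f \<in> borel_measurable borel"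
      note meas [measurable]
      have dA: "det A = (\<Prod>i\<in>UNIV. A $ i $ i)" using diag by (rule det_diagonal)
      let ?c = "\<lambda>b::real^'n. b \<bullet> (A *v b)"
      have c: "?c (axis i 1) = A $ i $ i" for i
        by (simp add: inner_axis' matrix_vector_mul_component inner_axis)
      have Bas: "(\<Sum>j\<in>Basis. g j) = (\<Sum>i\<in>UNIV. g (axis i (1::real)))" for g :: "real^'n \<Rightarrow> real^'n"
        unfolding Basis_vec_def
        by (subst sum.UNION_disjoint) (auto simp: axis_eq_axis)
      have Bap: "(\<Prod>j\<in>Basis. g j) = (\<Prod>i\<in>UNIV. g (axis i (1::real)))" for g :: "real^'n \<Rightarrow> real"
        unfolding Basis_vec_def
        by (subst prod.UNION_disjoint) (auto simp: axis_eq_axis)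
      have Ax: "A *v x = 0 + (\<Sum>j\<in>Basis. (?c j * (x \<bullet> j)) *\<^sub>R j)" for x
      proof (rule vec_eq_iff[THEN iffD2], rule allI)
        fix i
        have "(A *v x) $ i = (\<Sum>j\<in>{i}. A $ i $ j * x $ j)"
          unfolding matrix_vector_mult_def
          by (simp only: vec_lambda_beta, rule sum.mono_neutral_right) (auto simp: diag)
        also have "\<dots> = (0 + (\<Sum>j\<in>Basis. (?c j * (x \<bullet> j)) *\<^sub>R j)) $ i"
          unfolding Bas c inner_axis
          by (simp add: axis_def if_distrib[of "\<lambda>t. _ * t"] cong: if_cong)
        finally show "(A *v x) $ i = (0 + (\<Sum>j\<in>Basis. (?c j * (x \<bullet> j)) *\<^sub>R j)) $ i" .
      qed
      have nz: "?c j \<noteq> 0" if "j \<in> Basis" for j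
        using that d dA c by (auto simp: Basis_vec_def)
      have "lborel = density (distr lborel borel (\<lambda>x. 0 + (\<Sum>j\<in>Basis. (?c j * (x \<bullet> j)) *\<^sub>R j)))
          (\<lambda>_. (\<Prod>b\<in>Basis. \<bar>?c b\<bar>))"
        by (rule lborel_affine_euclidean) (rule nz)
      also have "(\<lambda>x. 0 + (\<Sum>j\<in>Basis. (?c j * (x \<bullet> j)) *\<^sub>R j)) = (\<lambda>x. A *v x)"
        by (rule ext) (rule Ax[symmetric])
      also have "(\<Prod>b\<in>Basis. \<bar>?c b\<bar>) = \<bar>det A\<bar>"
        unfolding Bap c dA by (simp add: abs_prod)
      finally have "(\<integral>\<^sup>+x. f x \<partial>lborel) = (\<integral>\<^sup>+x. f x \<partial>density (distr lborel borel (\<lambda>x. A *v x)) (\<lambda>_. ennreal \<bar>det A\<bar>))"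
        by simp
      then show "ennreal \<bar>det A\<bar> * (\<integral>\<^sup>+x. f (A *v x) \<partial>lborel) = (\<integral>\<^sup>+x. f x \<partial>lborel)"
        by (simp add: nn_integral_density nn_integral_distr nn_integral_cmult)
    qed
  next
    fix m n :: 'n
    assume "m \<noteq> n"
    let ?A = "(\<chi> i j. mat 1 $ i $ Transposition.transpose m n j) :: real^'n^'n"
    have Ax: "?A *v x = (\<chi> i. x $ Transposition.transpose m n i)" for x
    proof -
      have "(\<Sum>j\<in>UNIV. if i = Transposition.transpose m n j then x $ j else 0)
          = (\<Sum>j\<in>UNIV. if j = Transposition.transpose m n i then x $ j else 0)" for i
        by (rule sum.cong[OF refl]) (metis Transposition.transpose_involutory)
      then show ?thesis
        unfolding matrix_vector_mult_def mat_def
        by (simp add: vec_eq_iff if_distrib[of "\<lambda>t. t * _"] cong: if_cong)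
    qed
    have "det ?A = of_int (sign (Transposition.transpose m n)) * det (mat 1 :: real^'n^'n)"
      by (rule det_permute_columns) (simp add: permutes_swap_id)
    then have "\<bar>det ?A\<bar> = 1"
      by (simp add: sign_swap_id \<open>m \<noteq> n\<close>)
    then show "?P ?A"
      using nn_integral_lborel_swap[of _ m n] by (simp add: Ax)
  next
    fix m n :: 'n
    assume mn: "m \<noteq> n"
    let ?A = "(\<chi> i j. of_bool (i = m \<and> j = n \<or> i = j)) :: real^'n^'n"
    have "?A *v x = x + (x \<bullet> axis n 1) *\<^sub>R axis m 1" for x
    proof (rule vec_eq_iff[THEN iffD2], rule allI)
      fix i
      have "(\<Sum>j\<in>UNIV. of_bool (i = m \<and> j = n \<or> i = j) * x $ j)
          = (\<Sum>j\<in>UNIV. (if j = i then x $ j else 0) + (if j = n then (if i = m then x $ j else 0) else 0))"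
        using mn by (intro sum.cong) auto
      then show "(?A *v x) $ i = (x + (x \<bullet> axis n 1) *\<^sub>R axis m 1) $ i"
        unfolding inner_axis by (simp add: matrix_vector_mult_def sum.distrib axis_def)
    qed
    moreover have "det ?A = 1"
    proof -
      have "?A = (\<chi> k. if k = m then row m (mat 1) + 1 *s row n (mat 1) else row k (mat 1))"
        using mn by (simp add: vec_eq_iff row_def mat_def)
      then show ?thesis
        using det_row_operation[OF mn, of "mat 1" 1] by simp
    qed
    ultimately show "?P ?A"
      using nn_integral_lborel_shear[of _ "axis m 1" "axis n (1::real)"] mn
      by (simp add: axis_in_Basis_iff axis_eq_axis)
  qed
  then show ?thesis using assms by blast
qed

section \<open>Measurability of integrals in the measure\<close>

lemma growth_measures_sets: "\<nu> \<in> growth_measures \<Longrightarrow> sets \<nu> = sets borel"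
  by (simp add: growth_measures_def)

lemma growth_measures_space: "\<nu> \<in> growth_measures \<Longrightarrow> space \<nu> = UNIV"
  using sets_eq_imp_space_eq[of \<nu> borel] by (simp add: growth_measures_def)

lemma growth_measures_bounded_finite:
  fixes \<nu> :: "(real ^ 'n) measure"
  assumes \<nu>: "\<nu> \<in> growth_measures" and "bounded E"
  shows "emeasure \<nu> E < \<infinity>"
proof -
  obtain R where R: "R > 0" "E \<subseteq> ball 0 R"
    using bounded_subset_ballD[OF \<open>bounded E\<close>] by blast
  have "emeasure \<nu> (ball 0 R) / ennreal (R ^ CARD('n))
      \<le> (SUP R\<in>{0<..}. emeasure \<nu> (ball 0 R) / ennreal (R ^ CARD('n)))"
    by (rule SUP_upper) (use R in simp)
  also have "\<dots> < \<infinity>"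
    using \<nu> by (simp add: growth_measures_def)
  finally have "emeasure \<nu> (ball 0 R) < \<infinity>"
    using zero_less_power[OF R(1), of "CARD('n)"]
    by (auto simp: divide_ennreal_def inverse_ennreal ennreal_mult_less_top ennreal_eq_0_iff)
  moreover have "emeasure \<nu> E \<le> emeasure \<nu> (ball 0 R)"
    by (rule emeasure_mono) (use R growth_measures_sets[OF \<nu>] in auto)
  ultimately show ?thesis by (rule le_less_trans[rotated])
qed

lemma growth_measures_sigma_finite:
  fixes \<nu> :: "(real ^ 'n) measure"
  assumes "\<nu> \<in> growth_measures"
  shows "sigma_finite_measure \<nu>"
proof
  have fin: "emeasure \<nu> (ball 0 r) \<noteq> \<top>" for r
    using growth_measures_bounded_finite[OF assms bounded_ball, of 0 r] by simp
  show "\<exists>A. countable A \<and> A \<subseteq> sets \<nu> \<and> \<Union> A = space \<nu> \<and> (\<forall>a\<in>A. emeasure \<nu> a \<noteq> \<infinity>)"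
  proof (intro exI conjI)
    show "countable (range (\<lambda>n::nat. ball (0::real^'n) n))" by simp
    show "range (\<lambda>n::nat. ball (0::real^'n) n) \<subseteq> sets \<nu>"
      unfolding growth_measures_sets[OF assms] by (intro image_subsetI) simp
    show "\<Union> (range (\<lambda>n::nat. ball (0::real^'n) n)) = space \<nu>"
      unfolding growth_measures_space[OF assms]
      by (intro set_eqI iffI UNIV_I) (simp add: reals_Archimedean2)
    show "\<forall>a\<in>range (\<lambda>n::nat. ball (0::real^'n) n). emeasure \<nu> a \<noteq> \<infinity>"
      by (simp add: fin)
  qed
qed

lemma compactly_supported_continuous_integrable:
  fixes \<nu> :: "(real ^ 'n) measure"
  assumes \<nu>: "\<nu> \<in> growth_measures" and \<psi>: "\<psi> \<in> compactly_supported_continuous"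
  shows "integrable \<nu> \<psi>"
proof -
  let ?K = "closure {x. \<psi> x \<noteq> 0}"
  have c: "continuous_on UNIV \<psi>" and K: "compact ?K"
    using \<psi> by (auto simp: compactly_supported_continuous_def)
  have "bounded (\<psi> ` ?K)"
    using K c by (meson compact_continuous_image compact_imp_bounded continuous_on_subset subset_UNIV)
  then obtain B where B: "\<And>x. x \<in> ?K \<Longrightarrow> norm (\<psi> x) \<le> B"
    by (auto simp: bounded_iff)
  have meas: "\<psi> \<in> borel_measurable \<nu>"
    using borel_measurable_continuous_onI[OF c]
    by (simp add: measurable_cong_sets[OF growth_measures_sets[OF \<nu>] refl])
  show ?thesis
  proof (rule integrableI_bounded_set[where A = ?K and B = B])
    show "?K \<in> sets \<nu>" using growth_measures_sets[OF \<nu>] by simp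
    show "emeasure \<nu> ?K < \<infinity>"
      by (rule growth_measures_bounded_finite[OF \<nu> compact_imp_bounded[OF K]])
    show "AE x in \<nu>. x \<in> ?K \<longrightarrow> norm (\<psi> x) \<le> B" using B by auto
    show "AE x in \<nu>. x \<notin> ?K \<longrightarrow> \<psi> x = 0"
      using closure_subset[of "{x. \<psi> x \<noteq> 0}"] by auto
  qed (rule meas)
qed

lemma openin_weak_star_topology:
  assumes "\<psi> \<in> compactly_supported_continuous" "open U"
  shows "openin weak_star_topology {\<nu> \<in> growth_measures. (\<integral>x. \<psi> x \<partial>\<nu>) \<in> U}"
  unfolding weak_star_topology_def
  by (rule topology_generated_by_Basis) (use assms in blast)

lemma measurable_integral_compactly_supported_continuous:
  assumes "\<psi> \<in> compactly_supported_continuous"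
  shows "(\<lambda>\<nu>. \<integral>x. \<psi> x \<partial>\<nu>) \<in> borel_measurable growth_measures_borel"
proof (rule borel_measurableI)
  fix S :: "real set" assume "open S"
  then have "openin weak_star_topology {\<nu> \<in> growth_measures. (\<integral>x. \<psi> x \<partial>\<nu>) \<in> S}"
    by (rule openin_weak_star_topology[OF assms])
  then show "(\<lambda>\<nu>. \<integral>x. \<psi> x \<partial>\<nu>) -` S \<inter> space growth_measures_borel \<in> sets growth_measures_borel"
    unfolding space_growth_measures_borel sets_growth_measures_borel
    by (intro sigma_sets.Basic) (simp add: vimage_def Int_def conj_commute)
qed

text \<open>The indicator of \<open>V\<close> is the limit of the functions \<open>min 1 (k d(x, V\<^sup>c))\<close>, which are continuous and
  vanish outside \<open>V\<close>.\<close>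

lemma measurable_emeasure_open_bounded:
  fixes V :: "(real ^ 'n) set"
  assumes V: "open V" "bounded V"
  shows "(\<lambda>\<nu>. emeasure \<nu> V) \<in> borel_measurable growth_measures_borel"
proof -
  have ne: "- V \<noteq> {}"
    using V not_bounded_UNIV by (metis Compl_empty_eq double_complement)
  let ?f = "\<lambda>k x. min 1 (real k * infdist x (- V))"
  have supp: "?f k x = 0" if "x \<notin> V" for k x
    using that by simp
  have f: "?f k \<in> compactly_supported_continuous" for k
  proof -
    have "{x. ?f k x \<noteq> 0} \<subseteq> V" using supp by blast
    then have "compact (closure {x. ?f k x \<noteq> 0})"
      using V bounded_subset by (simp only: compact_closure) blast
    moreover have "continuous_on UNIV (?f k)"
      by (intro continuous_intros)
    ultimately show ?thesis by (simp add: compactly_supported_continuous_def)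
  qed
  have lim: "(\<lambda>k. ?f k x) \<longlonglongrightarrow> indicat_real V x" for x
  proof (cases "x \<in> V")
    case True
    have "infdist x (- V) > 0"
      using True V ne by (metis ComplD closed_Compl in_closed_iff_infdist_zero infdist_nonneg less_eq_real_def)
    then obtain k0 :: nat where k0: "1 < real k0 * infdist x (- V)"
      using reals_Archimedean3 by blast
    have "?f k x = 1" if "k \<ge> k0" for k
      using k0 that mult_right_mono[of "real k0" "real k" "infdist x (- V)"] by (simp add: infdist_nonneg)
    then have "\<forall>\<^sub>F k in sequentially. ?f k x = 1"
      by (auto simp: eventually_sequentially)
    then show ?thesis using True by (simp add: tendsto_eventually)
  next
    case False
    then show ?thesis using supp by simp
  qed
  have *: "(\<lambda>k. \<integral>x. ?f k x \<partial>\<nu>) \<longlonglongrightarrow> measure \<nu> V" if \<nu>: "\<nu> \<in> growth_measures" for \<nu>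
  proof -
    note [simp] = growth_measures_sets[OF \<nu>] growth_measures_space[OF \<nu>]
    have "(\<lambda>k. \<integral>x. ?f k x \<partial>\<nu>) \<longlonglongrightarrow> (\<integral>x. indicat_real V x \<partial>\<nu>)"
    proof (rule integral_dominated_convergence[where w = "indicat_real V"])
      show "integrable \<nu> (indicat_real V)"
        using V growth_measures_bounded_finite[OF \<nu> V(2)] by simp
      show "AE x in \<nu>. (\<lambda>k. ?f k x) \<longlonglongrightarrow> indicat_real V x" using lim by simp
      show "AE x in \<nu>. norm (?f k x) \<le> indicat_real V x" for k
        by (rule AE_I2) (auto simp: indicator_def infdist_nonneg)
      show "?f k \<in> borel_measurable \<nu>" for k
        using compactly_supported_continuous_integrable[OF \<nu> f] by blast
    qed (use V growth_measures_sets[OF \<nu>] in \<open>auto intro!: borel_measurable_indicator\<close>)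
    then show ?thesis using V by simp
  qed
  have "(\<lambda>\<nu>. measure \<nu> V) \<in> borel_measurable growth_measures_borel"
  proof (rule borel_measurable_LIMSEQ_real)
    show "(\<lambda>k. \<integral>x. ?f k x \<partial>\<nu>) \<longlonglongrightarrow> measure \<nu> V" if "\<nu> \<in> space growth_measures_borel" for \<nu>
      using * that by (simp add: space_growth_measures_borel)
  qed (rule measurable_integral_compactly_supported_continuous[OF f])
  then have "(\<lambda>\<nu>. ennreal (measure \<nu> V)) \<in> borel_measurable growth_measures_borel" by simp
  moreover have "emeasure \<nu> V = ennreal (measure \<nu> V)" if "\<nu> \<in> space growth_measures_borel" for \<nu>
    using that growth_measures_bounded_finite[OF _ V(2), of \<nu>]
    by (intro emeasure_eq_ennreal_measure) (simp add: space_growth_measures_borel)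
  ultimately show ?thesis by (simp cong: measurable_cong)
qed

text \<open>Bounded sets come first because complements need finite measure.\<close>

lemma measurable_emeasure_growth_measures:
  fixes E :: "(real ^ 'n) set"
  assumes E: "E \<in> sets borel"
  shows "(\<lambda>\<nu>. emeasure \<nu> E) \<in> borel_measurable growth_measures_borel"
proof -
  let ?G = "growth_measures_borel :: (real^'n) measure measure"
  have local: "(\<lambda>\<nu>. emeasure \<nu> (E \<inter> ball 0 (real n))) \<in> borel_measurable ?G" for n
  proof -
    let ?B = "ball (0::real^'n) (real n)"
    have stable: "Int_stable {S::(real^'n) set. open S}" by (auto simp: Int_stable_def)
    have "E \<in> sigma_sets UNIV {S. open S}"
      using E by (simp add: borel_def)
    with stable subset_UNIV[of "{S. open S}", folded Pow_UNIV] show ?thesis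
    proof (induction rule: sigma_sets_induct_disjoint)
      case (basic A)
      then show ?case
        by (intro measurable_emeasure_open_bounded) (auto intro: bounded_subset[OF bounded_ball])
    next
      case empty
      show ?case by simp
    next
      case (compl A)
      have A: "A \<in> sets borel" using compl(1) by (simp add: borel_def)
      have "(\<lambda>\<nu>. emeasure \<nu> ?B - emeasure \<nu> (A \<inter> ?B)) \<in> borel_measurable ?G"
        using compl(2) measurable_emeasure_open_bounded[of ?B] by simp
      moreover have "emeasure \<nu> ((UNIV - A) \<inter> ?B) = emeasure \<nu> ?B - emeasure \<nu> (A \<inter> ?B)"
        if "\<nu> \<in> space ?G" for \<nu>
      proof -
        have \<nu>: "\<nu> \<in> growth_measures" using that by (simp add: space_growth_measures_borel)
        have "(UNIV - A) \<inter> ?B = ?B - (A \<inter> ?B)" by auto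
        moreover have "emeasure \<nu> (A \<inter> ?B) \<noteq> \<infinity>"
          using growth_measures_bounded_finite[OF \<nu>, of "A \<inter> ?B"]
          by (metis bounded_Int bounded_ball less_irrefl)
        ultimately show ?thesis
          using A growth_measures_sets[OF \<nu>] by (simp add: emeasure_Diff)
      qed
      ultimately show ?case by (simp cong: measurable_cong)
    next
      case (union A)
      have A: "A i \<in> sets borel" for i using union(2) by (auto simp: borel_def)
      have "(\<lambda>\<nu>. \<Sum>i. emeasure \<nu> (A i \<inter> ?B)) \<in> borel_measurable ?G"
        using union(3) by simp
      moreover have "emeasure \<nu> ((\<Union>i. A i) \<inter> ?B) = (\<Sum>i. emeasure \<nu> (A i \<inter> ?B))"
        if "\<nu> \<in> space ?G" for \<nu>
      proof -
        have \<nu>: "\<nu> \<in> growth_measures" using that by (simp add: space_growth_measures_borel)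
        have "(\<Union>i. A i) \<inter> ?B = (\<Union>i. A i \<inter> ?B)" by auto
        moreover have "(\<Sum>i. emeasure \<nu> (A i \<inter> ?B)) = emeasure \<nu> (\<Union>i. A i \<inter> ?B)"
          by (rule suminf_emeasure)
             (use A union(1) growth_measures_sets[OF \<nu>] in \<open>auto simp: disjoint_family_on_def\<close>)
        ultimately show ?thesis by simp
      qed
      ultimately show ?case by (simp cong: measurable_cong)
    qed
  qed
  have "(\<lambda>\<nu>. SUP n. emeasure \<nu> (E \<inter> ball 0 (real n))) \<in> borel_measurable ?G"
    by (rule borel_measurable_SUP) (auto intro: local)
  moreover have "emeasure \<nu> E = (SUP n. emeasure \<nu> (E \<inter> ball 0 (real n)))" if "\<nu> \<in> space ?G" for \<nu>
  proof -
    have \<nu>: "\<nu> \<in> growth_measures" using that by (simp add: space_growth_measures_borel)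
    have "(\<Union>n. E \<inter> ball 0 (real n)) = E"
      by (simp add: set_eq_iff reals_Archimedean2)
    moreover have "(SUP n. emeasure \<nu> (E \<inter> ball 0 (real n))) = emeasure \<nu> (\<Union>n. E \<inter> ball 0 (real n))"
    proof (rule SUP_emeasure_incseq)
      show "range (\<lambda>n. E \<inter> ball 0 (real n)) \<subseteq> sets \<nu>"
        unfolding growth_measures_sets[OF \<nu>] using E by (intro image_subsetI sets.Int) simp_all
      show "incseq (\<lambda>n. E \<inter> ball 0 (real n))"
        by (intro monoI Int_mono subset_ball) simp_all
    qed
    ultimately show ?thesis by simp
  qed
  ultimately show ?thesis by (simp cong: measurable_cong)
qed

lemma measurable_nn_integral_growth_measures:
  fixes f :: "real ^ 'n \<Rightarrow> ennreal"
  assumes "f \<in> borel_measurable borel"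
  shows "(\<lambda>\<nu>. \<integral>\<^sup>+x. f x \<partial>\<nu>) \<in> borel_measurable growth_measures_borel"
proof -
  let ?G = "growth_measures_borel :: (real^'n) measure measure"
  have G: "sets \<nu> = sets borel" if "\<nu> \<in> space ?G" for \<nu>
    using that by (intro growth_measures_sets) (simp add: space_growth_measures_borel)
  have m: "g \<in> borel_measurable \<nu>" if "\<nu> \<in> space ?G" "g \<in> borel_measurable borel"
    for \<nu> and g :: "real^'n \<Rightarrow> ennreal"
    using that by (simp add: measurable_cong_sets[OF G refl])
  show ?thesis
    using assms
  proof (induction rule: borel_measurable_induct)
    case (cong f g)
    then have "f = g" by (auto simp: fun_eq_iff)
    with cong show ?case by simp
  next
    case (set A)
    have "(\<integral>\<^sup>+x. indicator A x \<partial>\<nu>) = emeasure \<nu> A" if "\<nu> \<in> space ?G" for \<nu>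
      using set G[OF that] by simp
    note eq = this
    show ?case
      by (subst measurable_cong[OF eq]) (auto intro: measurable_emeasure_growth_measures[OF set])
  next
    case (mult u c)
    have "(\<integral>\<^sup>+x. c * u x \<partial>\<nu>) = c * (\<integral>\<^sup>+x. u x \<partial>\<nu>)" if "\<nu> \<in> space ?G" for \<nu>
      by (rule nn_integral_cmult) (rule m[OF that mult(2)])
    note eq = this
    show ?case by (subst measurable_cong[OF eq]) (use mult in auto)
  next
    case (add u v)
    have "(\<integral>\<^sup>+x. v x + u x \<partial>\<nu>) = (\<integral>\<^sup>+x. v x \<partial>\<nu>) + (\<integral>\<^sup>+x. u x \<partial>\<nu>)" if "\<nu> \<in> space ?G" for \<nu>
      by (rule nn_integral_add[OF m[OF that] m[OF that]]) fact+
    note eq = this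
    show ?case by (subst measurable_cong[OF eq], assumption) (rule borel_measurable_add; fact)
  next
    case (seq U)
    have "(\<integral>\<^sup>+x. (SUP i. U i) x \<partial>\<nu>) = (SUP i. \<integral>\<^sup>+x. U i x \<partial>\<nu>)" if "\<nu> \<in> space ?G" for \<nu>
      unfolding SUP_apply
      by (rule nn_integral_monotone_convergence_SUP[OF _ m[OF that]]) fact+
    note eq = this
    have Ui: "(\<lambda>\<nu>. \<integral>\<^sup>+x. U i x \<partial>\<nu>) \<in> borel_measurable ?G" for i
      by fact
    have "(\<lambda>\<nu>. SUP i. \<integral>\<^sup>+x. U i x \<partial>\<nu>) \<in> borel_measurable ?G"
      by (rule borel_measurable_SUP) (auto intro: Ui)
    then show ?case by (subst measurable_cong[OF eq]) assumption
  qed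
qed

text \<open>The value \<open>0\<close> of the integral of a non-integrable function is a separate case.\<close>

lemma measurable_integral_growth_measures:
  fixes f :: "real ^ 'n \<Rightarrow> real"
  assumes f: "f \<in> borel_measurable borel"
  shows "(\<lambda>\<nu>. \<integral>x. f x \<partial>\<nu>) \<in> borel_measurable growth_measures_borel"
proof -
  let ?G = "growth_measures_borel :: (real^'n) measure measure"
  let ?p = "\<lambda>\<nu>. \<integral>\<^sup>+x. ennreal (f x) \<partial>\<nu>" and ?n = "\<lambda>\<nu>. \<integral>\<^sup>+x. ennreal (- f x) \<partial>\<nu>"
  have pn [measurable]: "?p \<in> borel_measurable ?G" "?n \<in> borel_measurable ?G"
    using f by (auto intro!: measurable_nn_integral_growth_measures)
  have "(\<integral>x. f x \<partial>\<nu>) = (if ?p \<nu> = \<infinity> \<or> ?n \<nu> = \<infinity> then 0 else enn2real (?p \<nu>) - enn2real (?n \<nu>))"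
    if "\<nu> \<in> space ?G" for \<nu>
  proof -
    have sets: "sets \<nu> = sets borel"
      using that by (intro growth_measures_sets) (simp add: space_growth_measures_borel)
    have meas: "f \<in> borel_measurable \<nu>" using f by (simp add: measurable_cong_sets[OF sets refl])
    show ?thesis
    proof (cases "integrable \<nu> f")
      case True
      then have "?p \<nu> \<noteq> \<infinity>" "?n \<nu> \<noteq> \<infinity>" by (auto simp: real_integrable_def)
      then show ?thesis using real_lebesgue_integral_def[OF True] by simp
    next
      case False
      then show ?thesis
        using meas not_integrable_integral_eq[OF False] by (auto simp: real_integrable_def)
    qed
  qed
  moreover have "(\<lambda>\<nu>. if ?p \<nu> = \<infinity> \<or> ?n \<nu> = \<infinity> then 0 else enn2real (?p \<nu>) - enn2real (?n \<nu>))
      \<in> borel_measurable ?G"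
    by measurable
  ultimately show ?thesis by (simp cong: measurable_cong)
qed

section \<open>Homogeneous measures and the action of the special linear group\<close>

definition homogeneous :: "(real ^ 'n) measure \<Rightarrow> bool" where
  "homogeneous \<nu> \<longleftrightarrow> sets \<nu> = sets borel \<and> (\<forall>r>0. dilate r \<nu> = \<nu>)"

text \<open>The factor by which a homogeneous measure differs from Lebesgue measure on radial functions.\<close>

definition ball_density :: "(real ^ 'n) measure \<Rightarrow> ennreal" where
  "ball_density \<nu> = emeasure \<nu> (ball 0 1) / emeasure lborel (ball (0 :: real ^ 'n) 1)"

lemma borel_measurable_matrix_vector_mult [measurable]:
  "(\<lambda>x. (A :: real ^ 'n ^ 'm) *v x) \<in> borel_measurable borel"
  by (intro borel_measurable_continuous_onI matrix_vector_mult_linear_continuous_on)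

lemma homogeneous_nn_integral:
  fixes \<nu> :: "(real ^ 'n) measure"
  assumes \<nu>: "homogeneous \<nu>" and r: "r > 0" and f [measurable]: "f \<in> borel_measurable borel"
  shows "(\<integral>\<^sup>+x. f x \<partial>\<nu>) = ennreal (r ^ CARD('n)) * (\<integral>\<^sup>+x. f (r *\<^sub>R x) \<partial>\<nu>)"
proof -
  have [measurable_cong]: "sets \<nu> = sets borel" and dil: "dilate (1 / r) \<nu> = \<nu>"
    using \<nu> r by (auto simp: homogeneous_def)
  have "1 / ennreal ((1 / r) ^ CARD('n)) = ennreal (r ^ CARD('n))"
    using r by (simp add: divide_ennreal_def inverse_ennreal power_one_over)
  then have "dilate (1 / r) \<nu> = scale_measure (ennreal (r ^ CARD('n))) (distr \<nu> borel (\<lambda>x. r *\<^sub>R x))"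
    using r by (simp add: dilate_def)
  then have "(\<integral>\<^sup>+x. f x \<partial>\<nu>)
      = (\<integral>\<^sup>+x. f x \<partial>scale_measure (ennreal (r ^ CARD('n))) (distr \<nu> borel (\<lambda>x. r *\<^sub>R x)))"
    using dil by simp
  also have "\<dots> = ennreal (r ^ CARD('n)) * (\<integral>\<^sup>+x. f (r *\<^sub>R x) \<partial>\<nu>)"
    by (simp add: nn_integral_scale_measure nn_integral_distr)
  finally show ?thesis .
qed

lemma homogeneous_lborel: "homogeneous (lborel :: (real ^ 'n) measure)"
  unfolding homogeneous_def
proof (intro conjI allI impI)
  fix r :: real assume r: "r > 0"
  have "lborel = density (distr lborel borel (\<lambda>x::real^'n. 0 + inverse r *\<^sub>R x)) (\<lambda>_. ennreal (\<bar>inverse r\<bar> ^ DIM(real^'n)))"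
    using r lborel_affine[of "inverse r" "0 :: real^'n"] by simp
  also have "\<dots> = dilate r lborel"
    by (rule measure_eqI)
       (use r in \<open>simp_all add: dilate_def emeasure_density_const divide_ennreal_def inverse_ennreal
          power_inverse\<close>)
  finally show "dilate r lborel = (lborel :: (real ^ 'n) measure)" ..
qed simp

lemma homogeneous_emeasure_ball:
  fixes \<nu> :: "(real ^ 'n) measure"
  assumes \<nu>: "homogeneous \<nu>" and r: "r > 0"
  shows "emeasure \<nu> (ball 0 r) = ennreal (r ^ CARD('n)) * emeasure \<nu> (ball 0 1)"
proof -
  have [measurable_cong]: "sets \<nu> = sets borel" using \<nu> by (auto simp: homogeneous_def)
  have "emeasure \<nu> (ball 0 r) = (\<integral>\<^sup>+x. indicator (ball 0 r) x \<partial>\<nu>)" by simp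
  also have "\<dots> = ennreal (r ^ CARD('n)) * (\<integral>\<^sup>+x. indicator (ball 0 r) (r *\<^sub>R x) \<partial>\<nu>)"
    by (intro homogeneous_nn_integral[OF \<nu> r] borel_measurable_indicator) simp
  also have "(\<lambda>x::real^'n. indicator (ball 0 r) (r *\<^sub>R x) :: ennreal) = indicator (ball 0 1)"
    using r by (auto simp: indicator_def fun_eq_iff)
  finally show ?thesis by simp
qed

lemma ball_density_finite:
  fixes \<nu> :: "(real ^ 'n) measure"
  assumes "\<nu> \<in> growth_measures"
  shows "ball_density \<nu> < \<infinity>"
  using growth_measures_bounded_finite[OF assms bounded_ball, of 0 1]
    emeasure_lborel_ball_finite[of "0::real^'n" 1] content_ball_pos[of 1 "0::real^'n"]
  by (auto simp: ball_density_def ennreal_divide_eq_top_iff less_top[symmetric] emeasure_eq_ennreal_measure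
      simp del: content_ball_pos)

text \<open>Both pushforwards under the norm are determined by the measures of the balls about the
  origin, and homogeneity fixes those up to one constant.\<close>

lemma homogeneous_nn_integral_radial:
  fixes \<nu> :: "(real ^ 'n) measure"
  assumes \<nu>: "homogeneous \<nu>" and fin: "emeasure \<nu> (ball 0 1) < \<infinity>"
    and h [measurable]: "h \<in> borel_measurable borel"
  shows "(\<integral>\<^sup>+x. h (norm x) \<partial>\<nu>) = ball_density \<nu> * (\<integral>\<^sup>+x. h (norm (x :: real ^ 'n)) \<partial>lborel)"
proof -
  have s [measurable_cong]: "sets \<nu> = sets borel" using \<nu> by (auto simp: homogeneous_def)
  have sp: "space \<nu> = UNIV" using sets_eq_imp_space_eq[OF s] by simp
  let ?D = "scale_measure (ball_density \<nu>) (distr lborel borel (norm :: real^'n \<Rightarrow> real))"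
  have v: "norm -` {..<a} = ball (0::real^'n) a" for a by auto
  have unit: "ball_density \<nu> * emeasure lborel (ball (0::real^'n) 1) = emeasure \<nu> (ball 0 1)"
  proof -
    have "emeasure lborel (ball (0::real^'n) 1) \<noteq> 0"
      using content_ball_pos[of 1 "0::real^'n"] by (auto simp: measure_def)
    then show ?thesis
      using emeasure_lborel_ball_finite[of "0::real^'n" 1]
      by (simp add: ball_density_def ennreal_divide_times ennreal_divide_self)
  qed
  have "distr \<nu> borel norm = ?D"
  proof (rule measure_eqI_generator_eq)
    have "{..<a} \<inter> {..<b} = {..<min a b}" for a b :: real by auto
    then show "Int_stable (range (lessThan :: real \<Rightarrow> _))"
      by (auto simp: Int_stable_def)
    show "range (lessThan :: real \<Rightarrow> _) \<subseteq> Pow UNIV" by simp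
    show "sets (distr \<nu> borel norm) = sigma_sets UNIV (range (lessThan :: real \<Rightarrow> _))"
      by (simp add: borel_Iio)
    show "sets ?D = sigma_sets UNIV (range (lessThan :: real \<Rightarrow> _))"
      by (simp add: borel_Iio)
    show "range (\<lambda>n. {..<real n}) \<subseteq> range (lessThan :: real \<Rightarrow> _)" by auto
    show "(\<Union>n. {..<real n}) = UNIV" by (simp add: set_eq_iff reals_Archimedean2)
    have dist: "emeasure (distr \<nu> borel norm) {..<a} = emeasure \<nu> (ball 0 a)" for a
      by (simp add: emeasure_distr v sp)
    show "emeasure (distr \<nu> borel norm) {..<real n} \<noteq> \<infinity>" for n
      using homogeneous_emeasure_ball[OF \<nu>, of "real n"] fin unfolding dist
      by (cases "n = 0") (auto simp: ennreal_mult_eq_top_iff)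
    fix X :: "real set" assume "X \<in> range lessThan"
    then obtain a where X: "X = {..<a}" by auto
    show "emeasure (distr \<nu> borel norm) X = emeasure ?D X"
    proof (cases "a > 0")
      case True
      then show ?thesis
        unfolding X dist homogeneous_emeasure_ball[OF \<nu> True]
        by (simp add: emeasure_distr v homogeneous_emeasure_ball[OF homogeneous_lborel True]
            unit[symmetric] mult_ac)
    next
      case False
      then have b: "ball (0::real^'n) a = {}" by simp
      show ?thesis unfolding X dist by (simp add: emeasure_distr v b)
    qed
  qed
  then have "(\<integral>\<^sup>+x. h x \<partial>distr \<nu> borel norm) = (\<integral>\<^sup>+x. h x \<partial>?D)" by simp
  then show ?thesis by (simp add: nn_integral_distr nn_integral_scale_measure)
qed

lemma sets_SL_act [simp]: "sets (SL_act g \<nu>) = sets borel"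
  by (simp add: SL_act_def)

lemma nn_integral_SL_act:
  assumes [measurable_cong]: "sets \<nu> = sets borel" and "f \<in> borel_measurable borel"
  shows "(\<integral>\<^sup>+x. f x \<partial>SL_act g \<nu>) = (\<integral>\<^sup>+x. f (g *v x) \<partial>\<nu>)"
  unfolding SL_act_def by (rule nn_integral_distr) (use assms in measurable)

lemma SL_act_lborel:
  assumes "g \<in> SL"
  shows "SL_act g lborel = (lborel :: (real ^ 'n) measure)"
proof (rule measure_eqI)
  fix E assume "E \<in> sets (SL_act g (lborel :: (real ^ 'n) measure))"
  then have E: "E \<in> sets borel" by simp
  have "emeasure (SL_act g lborel) E = (\<integral>\<^sup>+x. indicator E x \<partial>SL_act g lborel)"
    using E by simp
  also have "\<dots> = (\<integral>\<^sup>+x. indicator E (g *v x) \<partial>lborel)"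
    using E by (intro nn_integral_SL_act) auto
  also have "\<dots> = (\<integral>\<^sup>+x. indicator E x \<partial>lborel)"
    using nn_integral_lborel_linear[of g "indicator E"] assms E by (simp add: SL_def)
  finally show "emeasure (SL_act g lborel) E = emeasure lborel E" using E by simp
qed simp

lemma SL_inverse:
  fixes g :: "real ^ 'n ^ 'n"
  assumes "g \<in> SL"
  obtains h where "h \<in> SL" "\<And>x. h *v (g *v x) = x" "\<And>x. g *v (h *v x) = x"
proof -
  have "invertible g" using assms by (simp add: SL_def invertible_det_nz)
  then obtain h where h: "g ** h = mat 1" "h ** g = mat 1" by (auto simp: invertible_def)
  have "det (g ** h) = 1" by (simp add: h(1))
  then have "h \<in> SL" using assms by (simp add: SL_def det_mul)
  moreover have "h *v (g *v x) = x" "g *v (h *v x) = x" for x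
    by (simp_all add: matrix_vector_mul_assoc h)
  ultimately show ?thesis by (rule that)
qed

text \<open>The preimage of a ball of radius \<open>R\<close> lies in the ball of radius \<open>C R\<close>, where \<open>C\<close> bounds the
  operator norm of the inverse matrix.\<close>

lemma SL_act_growth_measures:
  fixes \<nu> :: "(real ^ 'n) measure"
  assumes \<nu>: "\<nu> \<in> growth_measures" and g: "g \<in> SL"
  shows "SL_act g \<nu> \<in> growth_measures"
proof -
  note s [measurable_cong] = growth_measures_sets[OF \<nu>]
  have sp: "space \<nu> = UNIV" by (rule growth_measures_space[OF \<nu>])
  obtain h where h: "\<And>x. h *v (g *v x) = x" using SL_inverse[OF g] by metis
  define C where "C = max 1 (onorm ((*v) h))"
  have C: "C > 0" and le: "norm x \<le> C * norm (g *v x)" for x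
  proof -
    show "C > 0" by (simp add: C_def)
    have "norm (h *v (g *v x)) \<le> onorm ((*v) h) * norm (g *v x)"
      by (rule onorm) simp
    also have "\<dots> \<le> C * norm (g *v x)"
      by (intro mult_right_mono) (simp_all add: C_def)
    finally show "norm x \<le> C * norm (g *v x)" by (simp add: h)
  qed
  let ?S = "SUP R\<in>{0<..}. emeasure \<nu> (ball 0 R) / ennreal (R ^ CARD('n))"
  have "emeasure (SL_act g \<nu>) (ball 0 R) / ennreal (R ^ CARD('n)) \<le> ennreal (C ^ CARD('n)) * ?S"
    if R: "R > 0" for R
  proof -
    have "emeasure (SL_act g \<nu>) (ball 0 R) = emeasure \<nu> ((*v) g -` ball 0 R)"
      unfolding SL_act_def by (subst emeasure_distr) (simp_all add: sp)
    also have "\<dots> \<le> emeasure \<nu> (ball 0 (C * R))"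
    proof (rule emeasure_mono)
      show "(*v) g -` ball 0 R \<subseteq> ball 0 (C * R)"
        using le_less_trans[OF le] C by (auto simp: mult_strict_left_mono)
    qed (simp add: s)
    finally have "emeasure (SL_act g \<nu>) (ball 0 R) / ennreal (R ^ CARD('n))
        \<le> emeasure \<nu> (ball 0 (C * R)) / ennreal (R ^ CARD('n))"
      by (rule divide_right_mono_ennreal)
    also have "\<dots> = ennreal (C ^ CARD('n)) * (emeasure \<nu> (ball 0 (C * R)) / ennreal ((C * R) ^ CARD('n)))"
    proof -
      have "ennreal (inverse (R ^ CARD('n))) = ennreal (C ^ CARD('n)) * ennreal (inverse ((C * R) ^ CARD('n)))"
        using C R by (simp add: ennreal_mult[symmetric] power_mult_distrib)
      then show ?thesis
        using C R by (simp add: divide_ennreal_def inverse_ennreal mult_ac)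
    qed
    also have "\<dots> \<le> ennreal (C ^ CARD('n)) * ?S"
      by (intro mult_left_mono SUP_upper) (use C R in auto)
    finally show ?thesis .
  qed
  then have "(SUP R\<in>{0<..}. emeasure (SL_act g \<nu>) (ball 0 R) / ennreal (R ^ CARD('n))) \<le> ennreal (C ^ CARD('n)) * ?S"
    by (intro SUP_least) auto
  also have "\<dots> < \<infinity>"
    using \<nu> by (simp add: growth_measures_def ennreal_mult_less_top)
  finally show ?thesis by (simp add: growth_measures_def)
qed

text \<open>Dilations commute with linear maps.\<close>

lemma homogeneous_SL_act:
  fixes \<nu> :: "(real ^ 'n) measure"
  assumes \<nu>: "homogeneous \<nu>"
  shows "homogeneous (SL_act g \<nu>)"
  unfolding homogeneous_def
proof (intro conjI allI impI)
  have [measurable_cong]: "sets \<nu> = sets borel" using \<nu> by (auto simp: homogeneous_def)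
  have scale: "distr (scale_measure c M) borel T = scale_measure c (distr M borel T)"
    if "T \<in> borel_measurable M" for c M and T :: "real ^ 'n \<Rightarrow> real ^ 'n"
  proof (rule measure_eqI)
    fix A assume "A \<in> sets (distr (scale_measure c M) borel T)"
    moreover have "T \<in> borel_measurable (scale_measure c M)" using that by simp
    ultimately show "emeasure (distr (scale_measure c M) borel T) A = emeasure (scale_measure c (distr M borel T)) A"
      using that by (simp add: emeasure_distr space_scale_measure)
  qed simp
  fix r :: real assume r: "r > 0"
  have "dilate r (SL_act g \<nu>) = SL_act g (dilate r \<nu>)"
    unfolding dilate_def SL_act_def
    by (subst scale, measurable) (simp add: distr_distr comp_def matrix_vector_mult_scaleR del: inverse_eq_divide)
  also have "dilate r \<nu> = \<nu>" using \<nu> r by (simp add: homogeneous_def)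
  finally show "dilate r (SL_act g \<nu>) = SL_act g \<nu>" .
qed simp

text \<open>The scaling factor is the \<open>n\<close>-th root of \<open>|det A|\<close>; composition with a reflection, which does not
  affect norms, corrects the sign of the determinant.\<close>

lemma invertible_norm_eq_scaled_SL:
  fixes A :: "real ^ 'n ^ 'n"
  assumes "det A \<noteq> 0"
  obtains g c where "g \<in> SL" "c > 0" "\<And>x. norm (A *v x) = c * norm (g *v x)"
proof -
  define k :: 'n where "k = undefined"
  let ?D = "\<lambda>d. (\<chi> i j. if i = j then d i else 0) :: real ^ 'n ^ 'n"
  have detD: "det (?D d) = (\<Prod>i\<in>UNIV. d i)" for d by (subst det_diagonal) auto
  have Dv: "?D d *v x = (\<chi> i. d i * x $ i)" for d x
    by (simp add: matrix_vector_mult_def if_distrib[of "\<lambda>t. t * _"] cong: if_cong)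
  define s where "s = sgn (det A)"
  have s: "s * s = 1" "\<bar>s\<bar> = 1" using assms by (auto simp: s_def sgn_if)
  define c where "c = root CARD('n) \<bar>det A\<bar>"
  have c: "c > 0" "c ^ CARD('n) = \<bar>det A\<bar>"
    using assms by (auto simp: c_def)
  \<comment> \<open>The diagonal matrix that divides by \<open>c\<close> and, for negative determinant, reflects one coordinate.\<close>
  define d where "d = (\<lambda>i. (if i = k then s else 1) / c)"
  have "det (?D d) = (\<Prod>i\<in>UNIV. (if i = k then s else 1)) / c ^ CARD('n)"
    by (simp add: detD d_def prod_dividef)
  then have detd: "det (?D d) = s / \<bar>det A\<bar>" by (simp add: c(2))
  show ?thesis
  proof
    show "?D d ** A \<in> SL"
      using assms by (simp add: SL_def det_mul detd s_def sgn_if)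
    show "c > 0" by (rule c)
    fix x
    have "norm (?D d *v y) = norm y / c" for y
    proof -
      have "(d i * y $ i)\<^sup>2 = (y $ i / c)\<^sup>2" for i
        using s by (simp add: d_def power_mult_distrib power_divide power2_eq_square)
      then have "norm (?D d *v y) = norm (y /\<^sub>R c)"
        by (simp add: Dv norm_vec_def L2_set_def divide_inverse mult.commute)
      then show ?thesis using c by (simp add: divide_inverse mult.commute)
    qed
    then show "norm (A *v x) = c * norm ((?D d ** A) *v x)"
      using c by (simp add: matrix_vector_mul_assoc[symmetric])
  qed
qed

text \<open>The function is radial after the change of variables by \<open>g\<close>, and the scale \<open>c\<close> enters on both sides
  in the same way.\<close>

lemma homogeneous_nn_integral_norm_linear:
  fixes \<nu> :: "(real ^ 'n) measure"
  assumes \<nu>: "homogeneous \<nu>" "\<nu> \<in> growth_measures" and g: "g \<in> SL"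
    and A: "\<And>x. norm (A *v x) = c * norm (g *v x)"
    and h [measurable]: "h \<in> borel_measurable borel"
  shows "(\<integral>\<^sup>+x. h (norm (A *v x)) \<partial>\<nu>)
    = ball_density (SL_act g \<nu>) * (\<integral>\<^sup>+x. h (norm (A *v x)) \<partial>(lborel :: (real ^ 'n) measure))"
proof -
  have s: "sets \<nu> = sets borel" using \<nu> by (auto simp: homogeneous_def)
  let ?h = "\<lambda>t. h (c * t)"
  have h': "?h \<in> borel_measurable borel" by measurable
  have "(\<integral>\<^sup>+x. h (norm (A *v x)) \<partial>\<nu>) = (\<integral>\<^sup>+y. ?h (norm y) \<partial>SL_act g \<nu>)"
    unfolding A by (subst nn_integral_SL_act[OF s]) auto
  also have "\<dots> = ball_density (SL_act g \<nu>) * (\<integral>\<^sup>+y. ?h (norm (y :: real ^ 'n)) \<partial>lborel)"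
    using growth_measures_bounded_finite[OF SL_act_growth_measures[OF \<nu>(2) g] bounded_ball]
    by (intro homogeneous_nn_integral_radial homogeneous_SL_act \<nu> h') auto
  also have "(\<integral>\<^sup>+y. ?h (norm (y :: real ^ 'n)) \<partial>lborel) = (\<integral>\<^sup>+y. ?h (norm (y :: real ^ 'n)) \<partial>SL_act g lborel)"
    by (simp add: SL_act_lborel[OF g])
  also have "\<dots> = (\<integral>\<^sup>+x. h (norm (A *v x)) \<partial>lborel)"
    unfolding A by (subst nn_integral_SL_act) auto
  finally show ?thesis .
qed

section \<open>Gaussian integrals of homogeneous measures\<close>

definition gauss :: "real ^ 'n \<Rightarrow> real ^ 'n \<Rightarrow> real" where
  "gauss \<xi> x = exp (- ((norm x)\<^sup>2 + (\<xi> \<bullet> x)\<^sup>2))"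

definition gauss_integral :: "(real ^ 'n) measure \<Rightarrow> real ^ 'n \<Rightarrow> real" where
  "gauss_integral \<nu> \<xi> = (\<integral>x. gauss \<xi> x \<partial>\<nu>)"

lemma gauss_pos: "gauss \<xi> x > 0" by (simp add: gauss_def)

lemma gauss_le: "gauss \<xi> x \<le> exp (- (norm x)\<^sup>2)" by (simp add: gauss_def)

lemma borel_measurable_gauss [measurable]: "gauss \<xi> \<in> borel_measurable borel"
  unfolding gauss_def by measurable

lemma nn_integral_exp_norm_square_finite:
  "(\<integral>\<^sup>+x. ennreal (exp (- (norm (x :: 'a::euclidean_space))\<^sup>2)) \<partial>lborel) < \<infinity>"
proof -
  have one: "(\<integral>\<^sup>+t. ennreal (exp (- t\<^sup>2)) \<partial>lborel) < \<infinity>"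
  proof -
    have i: "integrable lborel (\<lambda>t::real. indicator {0..} t *\<^sub>R exp (- t\<^sup>2))"
      using gaussian_moment_0 by (auto simp: has_bochner_integral_iff)
    have j: "integrable lborel (\<lambda>t::real. indicator {0..} (- t) *\<^sub>R exp (- t\<^sup>2))"
      using lborel_integrable_real_affine[OF i, of "-1" 0] by simp
    have "integrable lborel (\<lambda>t::real. exp (- t\<^sup>2))"
      by (rule Bochner_Integration.integrable_bound[OF Bochner_Integration.integrable_add[OF i j]])
         (auto simp: indicator_def)
    then show ?thesis by (simp add: integrable_iff_bounded)
  qed
  have "ennreal (exp (- (norm x)\<^sup>2)) = (\<Prod>b\<in>Basis. ennreal (exp (- (x \<bullet> b)\<^sup>2)))" for x :: 'a
  proof -
    have "(norm x)\<^sup>2 = (\<Sum>b\<in>Basis. (x \<bullet> b)\<^sup>2)"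
      unfolding power2_norm_eq_inner by (subst euclidean_inner) (simp add: power2_eq_square)
    then show ?thesis
      by (simp add: prod_ennreal exp_sum sum_negf[symmetric])
  qed
  then have "(\<integral>\<^sup>+x. ennreal (exp (- (norm (x :: 'a))\<^sup>2)) \<partial>lborel)
      = (\<integral>\<^sup>+x. (\<Prod>b\<in>Basis. ennreal (exp (- ((x :: 'a) \<bullet> b)\<^sup>2))) \<partial>lborel)" by simp
  also have "\<dots> = (\<Prod>b\<in>(Basis :: 'a set). (\<integral>\<^sup>+t. ennreal (exp (- t\<^sup>2)) \<partial>lborel))"
    by (rule nn_integral_lborel_prod) auto
  also have "\<dots> < \<infinity>" using one by (simp add: power_less_top_ennreal)
  finally show ?thesis .
qed

lemma integrable_exp_norm_square:
  fixes \<nu> :: "(real ^ 'n) measure"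
  assumes \<nu>: "homogeneous \<nu>" "\<nu> \<in> growth_measures"
  shows "integrable \<nu> (\<lambda>x. exp (- (norm x)\<^sup>2))"
proof -
  have s [measurable_cong]: "sets \<nu> = sets borel" using \<nu> by (auto simp: homogeneous_def)
  have "(\<integral>\<^sup>+x. ennreal (exp (- (norm x)\<^sup>2)) \<partial>\<nu>)
      = ball_density \<nu> * (\<integral>\<^sup>+x. ennreal (exp (- (norm (x :: real ^ 'n))\<^sup>2)) \<partial>lborel)"
    by (rule homogeneous_nn_integral_radial[OF \<nu>(1)])
       (use growth_measures_bounded_finite[OF \<nu>(2) bounded_ball] in auto)
  also have "\<dots> < \<infinity>"
    using ball_density_finite[OF \<nu>(2)] nn_integral_exp_norm_square_finite[where 'a = "real ^ 'n"]
    by (simp add: ennreal_mult_less_top)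
  finally show ?thesis by (simp add: integrable_iff_bounded)
qed

lemma gauss_integrable:
  assumes [measurable_cong]: "sets \<nu> = sets borel" and "integrable \<nu> (\<lambda>x. exp (- (norm x)\<^sup>2))"
  shows "integrable \<nu> (gauss \<xi>)"
  by (rule Bochner_Integration.integrable_bound[OF assms(2)])
     (auto simp: gauss_le order_less_imp_le[OF gauss_pos])

lemma continuous_gauss_integral:
  fixes \<nu> :: "(real ^ 'n) measure"
  assumes s [measurable_cong]: "sets \<nu> = sets borel" and int: "integrable \<nu> (\<lambda>x. exp (- (norm x)\<^sup>2))"
  shows "continuous_on UNIV (gauss_integral \<nu>)"
  unfolding continuous_on_sequentially comp_def
proof (intro allI impI ballI, elim conjE)
  fix \<xi> :: "nat \<Rightarrow> real ^ 'n" and a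
  assume \<xi>: "\<xi> \<longlonglongrightarrow> a"
  show "(\<lambda>n. gauss_integral \<nu> (\<xi> n)) \<longlonglongrightarrow> gauss_integral \<nu> a"
    unfolding gauss_integral_def
  proof (rule integral_dominated_convergence[OF _ _ int])
    have "(\<lambda>n. gauss (\<xi> n) x) \<longlonglongrightarrow> gauss a x" for x
      unfolding gauss_def by (intro tendsto_intros \<xi>)
    then show "AE x in \<nu>. (\<lambda>n. gauss (\<xi> n) x) \<longlonglongrightarrow> gauss a x" by simp
    show "AE x in \<nu>. norm (gauss (\<xi> n) x) \<le> exp (- (norm x)\<^sup>2)" for n
      by (simp add: gauss_le order_less_imp_le[OF gauss_pos])
  qed measurable
qed

lemma gauss_integral_nonneg: "gauss_integral \<nu> \<xi> \<ge> 0"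
  unfolding gauss_integral_def by (simp add: integral_nonneg_AE order_less_imp_le[OF gauss_pos])

lemma lborel_growth_measures: "(lborel :: (real ^ 'n) measure) \<in> growth_measures"
proof -
  have "emeasure lborel (ball (0::real^'n) R) / ennreal (R ^ CARD('n)) = emeasure lborel (ball (0::real^'n) 1)"
    if "R > 0" for R
    unfolding homogeneous_emeasure_ball[OF homogeneous_lborel that]
    using zero_less_power[OF that, of "CARD('n)"]
    by (subst mult.commute, intro ennreal_mult_divide_eq) (simp_all add: ennreal_eq_0_iff linorder_not_le)
  then have "(SUP R\<in>{0<..}. emeasure lborel (ball (0::real^'n) R) / ennreal (R ^ CARD('n)))
     \<le> emeasure lborel (ball (0::real^'n) 1)"
    by (intro SUP_least) simp
  also have "\<dots> < \<infinity>" by (rule emeasure_lborel_ball_finite)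
  finally show ?thesis by (simp add: growth_measures_def)
qed

lemma nn_integral_gauss:
  assumes "homogeneous \<nu>" "\<nu> \<in> growth_measures"
  shows "(\<integral>\<^sup>+x. ennreal (gauss \<xi> x) \<partial>\<nu>) = ennreal (gauss_integral \<nu> \<xi>)"
  unfolding gauss_integral_def
  by (rule nn_integral_eq_integral)
     (use assms in \<open>auto intro!: gauss_integrable integrable_exp_norm_square growth_measures_sets
        simp: order_less_imp_le[OF gauss_pos]\<close>)

lemma gauss_integral_lborel_pos: "gauss_integral (lborel :: (real ^ 'n) measure) \<xi> > 0"
proof -
  have "(\<integral>\<^sup>+x. ennreal (gauss \<xi> x) \<partial>lborel) \<noteq> 0"
  proof
    assume "(\<integral>\<^sup>+x. ennreal (gauss \<xi> x) \<partial>lborel) = 0"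
    then have "AE x in lborel. ennreal (gauss \<xi> x) = 0"
      by (subst (asm) nn_integral_0_iff_AE) auto
    then have "AE x in (lborel :: (real ^ 'n) measure). False"
      by (simp add: ennreal_eq_0_iff linorder_not_le[THEN iffD2, OF gauss_pos])
    then show False by (simp add: AE_iff_null null_sets_def)
  qed
  then show ?thesis
    unfolding nn_integral_gauss[OF homogeneous_lborel lborel_growth_measures]
    using gauss_integral_nonneg[of lborel \<xi>] by (simp add: ennreal_eq_0_iff)
qed

text \<open>The map is \<open>x \<mapsto> B x + t (\<xi> \<bullet> x) \<zeta>\<close> with \<open>\<xi> \<bullet> x = \<zeta> \<bullet> B x\<close> and \<open>t\<close> the positive root of
  \<open>2 t + t\<^sup>2 |\<zeta>|\<^sup>2 = 1\<close>.\<close>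

lemma rank_one_update_norm:
  fixes B :: "real ^ 'n ^ 'n"
  assumes "det B \<noteq> 0"
  obtains A :: "real ^ 'n ^ 'n"
  where "det A \<noteq> 0" "\<And>x. (norm (A *v x))\<^sup>2 = (norm (B *v x))\<^sup>2 + (\<xi> \<bullet> x)\<^sup>2"
proof -
  have "invertible B" using assms by (simp add: invertible_det_nz)
  then obtain C where C: "C ** B = mat 1" by (auto simp: invertible_def)
  have CB: "C *v (B *v x) = x" for x by (simp add: matrix_vector_mul_assoc C)
  define \<zeta> where "\<zeta> = transpose C *v \<xi>"
  have \<zeta>: "\<zeta> \<bullet> (B *v x) = \<xi> \<bullet> x" for x
    unfolding \<zeta>_def transpose_matrix_vector dot_lmul_matrix CB ..
  define s where "s = sqrt (1 + (norm \<zeta>)\<^sup>2)"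
  define t where "t = 1 / (1 + s)"
  have s: "s > 0" "s\<^sup>2 = 1 + (norm \<zeta>)\<^sup>2" by (simp_all add: s_def add_pos_nonneg)
  have t: "2 * t + t\<^sup>2 * (norm \<zeta>)\<^sup>2 = 1"
  proof -
    have p: "t * (1 + s) = 1" using s(1) by (simp add: t_def)
    have "2 * t + t\<^sup>2 * (s\<^sup>2 - 1) = 2 * t + (t * (1 + s)) * (t * (s - 1))"
      by (simp add: power2_eq_square algebra_simps)
    also have "\<dots> = 1" unfolding p using p by (simp add: algebra_simps)
    finally show ?thesis using s by simp
  qed
  define f where "f x = B *v x + (t * (\<xi> \<bullet> x)) *\<^sub>R \<zeta>" for x
  have lin: "linear f"
    by (rule linearI) (simp_all add: f_def matrix_vector_right_distrib inner_add_right matrix_vector_mult_scaleR algebra_simps)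
  have norm: "(norm (f x))\<^sup>2 = (norm (B *v x))\<^sup>2 + (\<xi> \<bullet> x)\<^sup>2" for x
  proof -
    have "(norm (f x))\<^sup>2 = (norm (B *v x))\<^sup>2 + 2 * (t * (\<xi> \<bullet> x)) * (\<zeta> \<bullet> (B *v x)) + (t * (\<xi> \<bullet> x))\<^sup>2 * (norm \<zeta>)\<^sup>2"
      unfolding f_def power2_norm_eq_inner
      by (simp add: inner_add_left inner_add_right inner_commute power2_eq_square algebra_simps)
    also have "\<dots> = (norm (B *v x))\<^sup>2 + (2 * t + t\<^sup>2 * (norm \<zeta>)\<^sup>2) * (\<xi> \<bullet> x)\<^sup>2"
      unfolding \<zeta> by (simp add: power2_eq_square algebra_simps)
    finally show ?thesis by (simp add: t)
  qed
  have "inj f"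
    unfolding linear_injective_0[OF lin]
  proof (intro allI impI)
    fix x assume "f x = 0"
    then have "(norm (B *v x))\<^sup>2 + (\<xi> \<bullet> x)\<^sup>2 = 0" using norm[of x] by simp
    then have "B *v x = 0" by (simp add: sum_power2_eq_zero_iff)
    then show "x = 0" using CB[of x] by simp
  qed
  then have "det (matrix f) \<noteq> 0" by (simp add: det_nz_iff_inj[OF lin])
  moreover have "matrix f *v x = f x" for x by (metis lin matrix_vector_mul)
  ultimately show ?thesis using norm by (intro that[of "matrix f"]) auto
qed

text \<open>The matrix \<open>g\<close> depends on \<open>\<xi>\<close> only, so that for an invariant law of \<open>\<nu>\<close> the ratio of Gaussian
  integrals is distributed like the ball density of \<open>\<nu>\<close>, whatever \<open>\<xi>\<close> is.\<close>

lemma gauss_integral_eq_ball_density: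
  fixes \<xi> :: "real ^ 'n"
  obtains g where "g \<in> SL"
    "\<And>\<nu>. homogeneous \<nu> \<Longrightarrow> \<nu> \<in> growth_measures \<Longrightarrow>
       gauss_integral \<nu> \<xi> = enn2real (ball_density (SL_act g \<nu>)) * gauss_integral lborel \<xi>"
proof -
  obtain A :: "real ^ 'n ^ 'n" where A: "det A \<noteq> 0" "\<And>x. (norm (A *v x))\<^sup>2 = (norm x)\<^sup>2 + (\<xi> \<bullet> x)\<^sup>2"
    using rank_one_update_norm[of "mat 1" \<xi>] by auto
  obtain g c where g: "g \<in> SL" "c > 0" "\<And>x. norm (A *v x) = c * norm (g *v x)"
    using invertible_norm_eq_scaled_SL[OF A(1)] by metis
  show ?thesis
  proof
    show "g \<in> SL" by (rule g)
    fix \<nu> :: "(real ^ 'n) measure" assume \<nu>: "homogeneous \<nu>" "\<nu> \<in> growth_measures"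
    have eq: "ennreal (gauss \<xi> x) = ennreal (exp (- (norm (A *v x))\<^sup>2))" for x
      by (simp add: gauss_def A(2))
    have "ennreal (gauss_integral \<nu> \<xi>) = ball_density (SL_act g \<nu>) * ennreal (gauss_integral lborel \<xi>)"
      unfolding nn_integral_gauss[OF \<nu>, symmetric]
        nn_integral_gauss[OF homogeneous_lborel lborel_growth_measures, symmetric] eq
      by (rule homogeneous_nn_integral_norm_linear[OF \<nu> g(1,3)]) measurable
    then show "gauss_integral \<nu> \<xi> = enn2real (ball_density (SL_act g \<nu>)) * gauss_integral lborel \<xi>"
      by (metis enn2real_ennreal enn2real_mult gauss_integral_nonneg)
  qed
qed

text \<open>By Tonelli both sides integrate the function \<open>x \<mapsto> \<integral> exp(- |\<xi>|\<^sup>2) gauss \<xi> x d\<xi>\<close>, which is radial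
  because a rotation of \<open>x\<close> can be absorbed into \<open>\<xi>\<close>.\<close>

lemma nn_integral_gauss_mean:
  fixes \<nu> :: "(real ^ 'n) measure"
  assumes \<nu>: "homogeneous \<nu>" "\<nu> \<in> growth_measures"
  shows "(\<integral>\<^sup>+\<xi>. ennreal (exp (- (norm \<xi>)\<^sup>2) * gauss_integral \<nu> \<xi>) \<partial>lborel)
    = ball_density \<nu> * (\<integral>\<^sup>+\<xi>. ennreal (exp (- (norm (\<xi> :: real ^ 'n))\<^sup>2) * gauss_integral lborel \<xi>) \<partial>lborel)"
proof -
  let ?f = "\<lambda>\<xi> x :: real ^ 'n. ennreal (exp (- (norm \<xi>)\<^sup>2) * gauss \<xi> x)"
  have f [measurable]: "case_prod ?f \<in> borel_measurable (borel \<Otimes>\<^sub>M borel)"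
    unfolding gauss_def by measurable
  let ?G = "\<lambda>x. \<integral>\<^sup>+\<xi>. ?f \<xi> x \<partial>lborel"
  have G [measurable]: "?G \<in> borel_measurable borel" by measurable
  obtain k :: 'n where True by simp
  have rad: "?G x = ?G (norm x *\<^sub>R axis k 1)" for x
  proof -
    have "norm x = norm (norm x *\<^sub>R axis k (1 :: real))" by simp
    then obtain T :: "real ^ 'n \<Rightarrow> real ^ 'n" where T: "orthogonal_transformation T" "T x = norm x *\<^sub>R axis k 1"
      by (rule orthogonal_transformation_exists)
    let ?y = "norm x *\<^sub>R axis k 1"
    have Tm: "T \<xi> = matrix T *v \<xi>" for \<xi>
      using T(1) by (metis matrix_works orthogonal_transformation_linear linear_matrix_vector_mul_eq matrix_vector_mul)
    have d: "\<bar>det (matrix T)\<bar> = 1"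
      using T(1) by (metis orthogonal_transformation_det)
    have "?G x = (\<integral>\<^sup>+\<xi>. ?f (matrix T *v \<xi>) ?y \<partial>lborel)"
      unfolding Tm[symmetric] gauss_def T(2)[symmetric]
      using T(1) by (simp add: orthogonal_transformation_norm orthogonal_transformation_def)
    also have "\<dots> = ?G ?y"
      using nn_integral_lborel_linear[of "matrix T" "\<lambda>\<xi>. ?f \<xi> ?y"] d by fastforce
    finally show ?thesis .
  qed
  have swap: "(\<integral>\<^sup>+\<xi>. ennreal (exp (- (norm \<xi>)\<^sup>2) * gauss_integral \<nu> \<xi>) \<partial>lborel) = (\<integral>\<^sup>+x. ?G x \<partial>\<nu>)"
    if \<nu>: "homogeneous \<nu>" "\<nu> \<in> growth_measures" for \<nu>
  proof -
    have [measurable_cong]: "sets \<nu> = sets borel" using \<nu> by (auto simp: homogeneous_def)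
    interpret N: sigma_finite_measure \<nu> by (rule growth_measures_sigma_finite[OF \<nu>(2)])
    interpret pair_sigma_finite \<nu> lborel ..
    have "ennreal (exp (- (norm \<xi>)\<^sup>2) * gauss_integral \<nu> \<xi>) = (\<integral>\<^sup>+x. ?f \<xi> x \<partial>\<nu>)" for \<xi>
      by (simp add: ennreal_mult' gauss_integral_nonneg nn_integral_cmult nn_integral_gauss[OF \<nu>])
    then have "(\<integral>\<^sup>+\<xi>. ennreal (exp (- (norm \<xi>)\<^sup>2) * gauss_integral \<nu> \<xi>) \<partial>lborel)
        = (\<integral>\<^sup>+\<xi>. (\<integral>\<^sup>+x. ?f \<xi> x \<partial>\<nu>) \<partial>lborel)" by simp
    also have "\<dots> = (\<integral>\<^sup>+x. ?G x \<partial>\<nu>)"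
      by (rule Fubini') measurable
    finally show ?thesis .
  qed
  have "(\<integral>\<^sup>+x. ?G x \<partial>\<nu>) = (\<integral>\<^sup>+x. ?G (norm x *\<^sub>R axis k 1) \<partial>\<nu>)"
    by (rule nn_integral_cong) (rule rad)
  also have "\<dots> = ball_density \<nu> * (\<integral>\<^sup>+x. ?G (norm (x :: real ^ 'n) *\<^sub>R axis k 1) \<partial>lborel)"
    by (rule homogeneous_nn_integral_radial[OF \<nu>(1), where h = "\<lambda>s. ?G (s *\<^sub>R axis k 1)"])
       (use growth_measures_bounded_finite[OF \<nu>(2) bounded_ball] in auto)
  also have "(\<integral>\<^sup>+x. ?G (norm (x :: real ^ 'n) *\<^sub>R axis k 1) \<partial>lborel) = (\<integral>\<^sup>+x. ?G x \<partial>lborel)"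
    by (rule nn_integral_cong) (rule rad[symmetric])
  finally show ?thesis
    unfolding swap[OF \<nu>] swap[OF homogeneous_lborel lborel_growth_measures] .
qed

section \<open>Strict convexity and joint measurability\<close>

lemma reciprocal_tangent_gap:
  fixes r c :: real
  assumes "r \<ge> 0" "c \<ge> 0"
  shows "1 / (1 + r) - 1 / (1 + c) + (r - c) / (1 + c)\<^sup>2 = (r - c)\<^sup>2 / ((1 + r) * (1 + c)\<^sup>2)"
proof -
  define a b where "a = 1 + r" and "b = 1 + c"
  have "a > 0" "b > 0" using assms by (auto simp: a_def b_def)
  then have "1 / a - 1 / b + (a - b) / b\<^sup>2 = (a - b)\<^sup>2 / (a * b\<^sup>2)"
    by (simp add: field_simps power2_eq_square)
  then show ?thesis by (simp add: a_def b_def)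
qed

text \<open>The gap between \<open>1 / (1 + t)\<close> and its tangent at \<open>c\<close> is a positive multiple of \<open>(t - c)\<^sup>2\<close>.  This
  convex function is chosen because it is bounded for \<open>t \<ge> 0\<close>: it can be integrated over \<open>\<mu>\<close>
  without any moment bound for the ball density.\<close>

lemma (in finite_measure) reciprocal_Jensen:
  fixes r :: "'a \<Rightarrow> real"
  assumes r: "integrable M r" "\<And>x. r x \<ge> 0" and c: "c \<ge> 0"
    and mean: "(\<integral>x. r x \<partial>M) = c * measure M (space M)"
  shows reciprocal_Jensen_le: "measure M (space M) / (1 + c) \<le> (\<integral>x. 1 / (1 + r x) \<partial>M)"
    and reciprocal_Jensen_eq:
      "(\<integral>x. 1 / (1 + r x) \<partial>M) = measure M (space M) / (1 + c) \<Longrightarrow> AE x in M. r x = c"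
proof -
  have [measurable]: "r \<in> borel_measurable M" using r by simp
  let ?gap = "\<lambda>x. 1 / (1 + r x) - 1 / (1 + c) + (r x - c) / (1 + c)\<^sup>2"
  have phi: "integrable M (\<lambda>x. 1 / (1 + r x))"
    by (rule integrable_const_bound[where B = 1]) (use r(2) in \<open>auto simp: divide_simps add_nonneg_pos\<close>)
  have int: "integrable M ?gap"
    using phi r by (intro Bochner_Integration.integrable_add Bochner_Integration.integrable_diff
        integrable_divide) auto
  have "(\<integral>x. ?gap x \<partial>M)
      = (\<integral>x. 1 / (1 + r x) \<partial>M) - measure M (space M) * (1 / (1 + c))
        + ((\<integral>x. r x \<partial>M) - measure M (space M) * c) / (1 + c)\<^sup>2"
    using phi r by simp
  then have gap: "(\<integral>x. ?gap x \<partial>M) = (\<integral>x. 1 / (1 + r x) \<partial>M) - measure M (space M) / (1 + c)"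
    by (simp add: mean)
  have eq: "?gap x = (r x - c)\<^sup>2 / ((1 + r x) * (1 + c)\<^sup>2)" for x
    by (rule reciprocal_tangent_gap) (use r c in auto)
  have nn: "?gap x \<ge> 0" for x unfolding eq using r(2)[of x] c by simp
  have "(\<integral>x. ?gap x \<partial>M) \<ge> 0" by (rule integral_nonneg_AE) (use nn in auto)
  then show "measure M (space M) / (1 + c) \<le> (\<integral>x. 1 / (1 + r x) \<partial>M)" using gap by simp
  assume "(\<integral>x. 1 / (1 + r x) \<partial>M) = measure M (space M) / (1 + c)"
  then have "(\<integral>x. ?gap x \<partial>M) = 0" using gap by simp
  then have "AE x in M. ?gap x = 0"
    using integral_nonneg_eq_0_iff_AE[OF int] nn by auto
  then show "AE x in M. r x = c"
  proof eventually_elim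
    case (elim x)
    then show ?case unfolding eq using r(2)[of x] c by (auto simp: add_nonneg_eq_0_iff)
  qed
qed

lemma continuous_AE_lborel_eq:
  fixes f g :: "'a::euclidean_space \<Rightarrow> real"
  assumes "continuous_on UNIV f" "continuous_on UNIV g" "AE x in lborel. f x = g x"
  shows "f x = g x"
proof (rule ccontr)
  assume ne: "f x \<noteq> g x"
  have "open {x. f x \<noteq> g x}"
    by (rule open_Collect_neq) (use assms in auto)
  then obtain e where e: "e > 0" "ball x e \<subseteq> {x. f x \<noteq> g x}"
    using ne openE[of "{x. f x \<noteq> g x}" x] by auto
  have "AE y in lborel. y \<notin> ball x e" using assms(3) e by (auto elim!: eventually_mono)
  then have "emeasure lborel (ball x e) = 0" by (subst (asm) AE_iff_measurable[of "ball x e"]) (auto simp del: mem_ball)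
  then have "measure lborel (ball x e) = 0" by (simp add: measure_def)
  then show False using content_ball_pos[OF e(1), of x] by simp
qed

text \<open>Replacing the second argument by simple functions that converge to it leaves countably many
  measurable sections to be combined.\<close>

lemma borel_measurable_Caratheodory:
  fixes f :: "'a \<Rightarrow> 'b::{metric_space, second_countable_topology} \<Rightarrow> real"
  assumes meas: "\<And>\<xi>. (\<lambda>\<nu>. f \<nu> \<xi>) \<in> borel_measurable M"
    and cont: "\<And>\<nu>. \<nu> \<in> space M \<Longrightarrow> continuous_on UNIV (f \<nu>)"
  shows "(\<lambda>p. f (fst p) (snd p)) \<in> borel_measurable (M \<Otimes>\<^sub>M borel)"
proof -
  obtain q :: "nat \<Rightarrow> 'b \<Rightarrow> 'b" where q: "\<And>i. simple_function borel (q i)" "\<And>\<xi>. (\<lambda>i. q i \<xi>) \<longlonglongrightarrow> \<xi>"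
    using borel_measurable_implies_sequence_metric[of "\<lambda>x::'b. x" borel undefined] by auto
  show ?thesis
  proof (rule borel_measurable_LIMSEQ_real)
    fix p assume "p \<in> space (M \<Otimes>\<^sub>M (borel :: 'b measure))"
    then have "continuous_on UNIV (f (fst p))"
      by (intro cont) (auto simp: space_pair_measure)
    then show "(\<lambda>i. f (fst p) (q i (snd p))) \<longlonglongrightarrow> f (fst p) (snd p)"
      by (rule continuous_on_tendsto_compose[OF _ q(2)]) auto
  next
    fix i
    have fin: "finite (range (q i))" using q(1)[of i] by (auto simp: simple_function_def)
    have m: "(\<lambda>p. q i (snd p)) \<in> measurable (M \<Otimes>\<^sub>M borel) (count_space (range (q i)))"
      using q(1)[of i] fin
      by (intro measurable_compose[OF measurable_snd]) (auto simp: measurable_count_space_eq2 simple_function_def)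
    show "(\<lambda>p. f (fst p) (q i (snd p))) \<in> borel_measurable (M \<Otimes>\<^sub>M borel)"
      by (rule measurable_compose_countable'[OF _ m, where f = "\<lambda>\<xi> p. f (fst p) \<xi>"])
         (use fin in \<open>auto intro: measurable_compose[OF measurable_fst meas] countable_finite\<close>)
  qed
qed


section \<open>Gaussian integrals of almost every measure\<close>

locale homogeneous_siegel =
  fixes \<mu> :: "(real ^ 'n) measure measure"
  assumes siegel: "siegel_measure \<mu>"
    and AE_homogeneous: "AE \<nu> in \<mu>. homogeneous \<nu>"
begin

sublocale prob_space \<mu> using siegel by (simp add: siegel_measure_def)

lemma sets_\<mu> [measurable_cong]: "sets \<mu> = sets growth_measures_borel"
  using siegel by (simp add: siegel_measure_def)

lemma space_\<mu>: "space \<mu> = growth_measures"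
  using sets_eq_imp_space_eq[OF sets_\<mu>] by (simp add: space_growth_measures_borel)

lemma measurable_\<mu>I: "f \<in> measurable growth_measures_borel N \<Longrightarrow> f \<in> measurable \<mu> N"
  by (simp add: measurable_cong_sets[OF sets_\<mu> refl])

lemma emeasure_SL_act_vimage:
  "g \<in> SL \<Longrightarrow> A \<in> sets \<mu> \<Longrightarrow> emeasure \<mu> (SL_act g -` A \<inter> space \<mu>) = emeasure \<mu> A"
  using siegel by (simp add: siegel_measure_def)

text \<open>A preimage of positive measure is measurable because \<open>emeasure\<close> vanishes off the
  \<open>\<sigma>\<close>-algebra; a null set is reached by passing to its complement.\<close>

lemma measurable_SL_act:
  assumes g: "g \<in> SL"
  shows "SL_act g \<in> measurable \<mu> \<mu>"
proof (rule measurableI)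
  show "SL_act g \<nu> \<in> space \<mu>" if "\<nu> \<in> space \<mu>" for \<nu>
    using that SL_act_growth_measures[OF _ g] by (simp add: space_\<mu>)
  have pos: "SL_act g -` A \<inter> space \<mu> \<in> sets \<mu>" if "A \<in> sets \<mu>" "emeasure \<mu> A \<noteq> 0" for A
    using emeasure_SL_act_vimage[OF g that(1)] that(2) emeasure_notin_sets by metis
  fix A assume A: "A \<in> sets \<mu>"
  show "SL_act g -` A \<inter> space \<mu> \<in> sets \<mu>"
  proof (cases "emeasure \<mu> A = 0")
    case False
    then show ?thesis by (rule pos[OF A])
  next
    case True
    then have "emeasure \<mu> (space \<mu> - A) \<noteq> 0"
      using A emeasure_compl[of A \<mu>] by (simp add: emeasure_space_1)
    then have "SL_act g -` (space \<mu> - A) \<inter> space \<mu> \<in> sets \<mu>"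
      using A by (intro pos) auto
    moreover have "SL_act g -` A \<inter> space \<mu> = space \<mu> - (SL_act g -` (space \<mu> - A) \<inter> space \<mu>)"
      using SL_act_growth_measures[OF _ g] by (auto simp: space_\<mu>)
    ultimately show ?thesis by (metis sets.compl_sets)
  qed
qed

lemma distr_SL_act:
  assumes g: "g \<in> SL"
  shows "distr \<mu> \<mu> (SL_act g) = \<mu>"
  by (rule measure_eqI)
     (use emeasure_SL_act_vimage[OF g] measurable_SL_act[OF g] in \<open>auto simp: emeasure_distr\<close>)

lemma AE_SL_act:
  assumes g: "g \<in> SL" and "AE \<nu> in \<mu>. P \<nu>"
  shows "AE \<nu> in \<mu>. P (SL_act g \<nu>)"
  by (rule AE_distrD[OF measurable_SL_act[OF g]], subst distr_SL_act[OF g]) (rule assms(2))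

lemma AE_homogeneous_growth: "AE \<nu> in \<mu>. homogeneous \<nu> \<and> \<nu> \<in> growth_measures"
  using AE_homogeneous AE_space by eventually_elim (simp add: space_\<mu>)

lemma measurable_ball_density [measurable]: "ball_density \<in> borel_measurable \<mu>"
  unfolding ball_density_def[abs_def]
  using measurable_\<mu>I[OF measurable_emeasure_growth_measures[of "ball 0 1"]] by simp

text \<open>For each \<open>\<nu>\<close> the mean over \<open>\<xi>\<close> of the ratio \<open>r \<nu> \<xi>\<close> is \<open>c \<nu>\<close>, while for each \<open>\<xi>\<close> the law over \<open>\<nu>\<close>
  of \<open>r \<nu> \<xi>\<close> is that of \<open>c \<nu>\<close>.  Integrating \<open>1 / (1 + r)\<close> over both variables in the two orders
  gives equality on average in Jensen's inequality, hence equality for almost every \<open>\<nu>\<close>.\<close>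

lemma AE_gauss_integral_eq_ball_density:
  "AE \<nu> in \<mu>. \<forall>\<xi>. gauss_integral \<nu> \<xi> = enn2real (ball_density \<nu>) * gauss_integral lborel \<xi>"
proof -
  let ?L = "lborel :: (real ^ 'n) measure"
  define c where "c \<nu> = enn2real (ball_density \<nu>)" for \<nu> :: "(real ^ 'n) measure"
  \<comment> \<open>Cutting off at the measures with a finite Gaussian integral makes \<open>r \<nu>\<close> continuous for every \<open>\<nu>\<close>.\<close>
  define Gd where "Gd = {\<nu> \<in> space \<mu>. (\<integral>\<^sup>+x. ennreal (exp (- (norm x)\<^sup>2)) \<partial>\<nu>) < \<infinity>}"
  define r where "r \<nu> \<xi> = indicator Gd \<nu> * gauss_integral \<nu> \<xi> / gauss_integral ?L \<xi>" for \<nu> \<xi>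
  have cont_L: "continuous_on UNIV (gauss_integral ?L)"
    by (intro continuous_gauss_integral integrable_exp_norm_square homogeneous_lborel lborel_growth_measures) simp
  have L_nz: "gauss_integral ?L \<xi> \<noteq> 0" for \<xi>
    using gauss_integral_lborel_pos[of \<xi>] by simp
  have c_meas [measurable]: "c \<in> borel_measurable \<mu>" unfolding c_def[abs_def] by measurable
  have c_nn: "c \<nu> \<ge> 0" for \<nu> by (simp add: c_def)
  have r_nn: "r \<nu> \<xi> \<ge> 0" for \<nu> \<xi>
    unfolding r_def by (simp add: gauss_integral_nonneg)
  have Gd_meas [measurable]: "Gd \<in> sets \<mu>"
  proof -
    have [measurable]: "(\<lambda>\<nu>. \<integral>\<^sup>+x. ennreal (exp (- (norm (x :: real ^ 'n))\<^sup>2)) \<partial>\<nu>) \<in> borel_measurable \<mu>"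
      by (intro measurable_\<mu>I measurable_nn_integral_growth_measures) measurable
    show ?thesis unfolding Gd_def by measurable
  qed
  have good_Gd: "\<nu> \<in> Gd" if "homogeneous \<nu>" "\<nu> \<in> growth_measures" for \<nu>
    using integrable_exp_norm_square[OF that] that by (simp add: Gd_def space_\<mu> integrable_iff_bounded)
  have cont: "continuous_on UNIV (r \<nu>)" if \<nu>: "\<nu> \<in> space \<mu>" for \<nu>
  proof (cases "\<nu> \<in> Gd")
    case True
    have s: "sets \<nu> = sets borel" using \<nu> by (intro growth_measures_sets) (simp add: space_\<mu>)
    have "(\<lambda>x. exp (- (norm x)\<^sup>2)) \<in> borel_measurable \<nu>"
      by (simp add: measurable_cong_sets[OF s refl])
    then have "integrable \<nu> (\<lambda>x. exp (- (norm x)\<^sup>2))"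
      using True by (simp add: Gd_def integrable_iff_bounded)
    then have "continuous_on UNIV (gauss_integral \<nu>)"
      by (rule continuous_gauss_integral[OF s])
    then have "continuous_on UNIV (\<lambda>\<xi>. gauss_integral \<nu> \<xi> / gauss_integral ?L \<xi>)"
      using cont_L by (rule continuous_on_divide) (simp add: L_nz)
    moreover have "r \<nu> = (\<lambda>\<xi>. gauss_integral \<nu> \<xi> / gauss_integral ?L \<xi>)"
      using True by (simp add: r_def[abs_def])
    ultimately show ?thesis by simp
  next
    case False
    then have "r \<nu> = (\<lambda>\<xi>. 0)" by (simp add: r_def[abs_def])
    then show ?thesis by simp
  qed
  have r_meas1: "(\<lambda>\<nu>. r \<nu> \<xi>) \<in> borel_measurable \<mu>" for \<xi>
  proof -
    have [measurable]: "(\<lambda>\<nu>. gauss_integral \<nu> \<xi>) \<in> borel_measurable \<mu>"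
      unfolding gauss_integral_def
      by (intro measurable_\<mu>I measurable_integral_growth_measures borel_measurable_gauss)
    show ?thesis unfolding r_def by measurable
  qed
  have r_meas: "(\<lambda>p. r (fst p) (snd p)) \<in> borel_measurable (\<mu> \<Otimes>\<^sub>M borel)"
    by (rule borel_measurable_Caratheodory[OF r_meas1 cont])
  \<comment> \<open>The weight makes the total mass and the mean of \<open>r \<nu>\<close> into Gaussian double integrals.\<close>
  define w where "w \<xi> = exp (- (norm \<xi>)\<^sup>2) * gauss_integral ?L \<xi>" for \<xi>
  define m where "m = density ?L (\<lambda>\<xi>. ennreal (w \<xi>))"
  have w_pos: "w \<xi> > 0" for \<xi> by (simp add: w_def gauss_integral_lborel_pos)
  have w_meas [measurable]: "w \<in> borel_measurable borel"
    unfolding w_def[abs_def] using borel_measurable_continuous_onI[OF cont_L] by measurable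
  have m_sets [measurable_cong]: "sets m = sets borel" by (simp add: m_def)
  have m_space: "space m = UNIV" by (simp add: m_def)
  have w_le: "gauss_integral ?L \<xi> \<le> gauss_integral ?L 0" for \<xi> :: "real ^ 'n"
    unfolding gauss_integral_def
    by (intro integral_mono gauss_integrable integrable_exp_norm_square homogeneous_lborel lborel_growth_measures)
       (simp_all add: gauss_def)
  have m_fin: "emeasure m (space m) < \<infinity>"
  proof -
    have "emeasure m (space m) = (\<integral>\<^sup>+\<xi>. ennreal (w \<xi>) \<partial>?L)"
      by (simp add: m_def emeasure_density)
    also have "\<dots> \<le> (\<integral>\<^sup>+\<xi>. ennreal (gauss_integral ?L 0) * ennreal (exp (- (norm \<xi>)\<^sup>2)) \<partial>?L)"
      by (intro nn_integral_mono)
         (auto simp: w_def ennreal_mult[symmetric] gauss_integral_nonneg mult.commute[of "exp _"]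
           intro!: ennreal_leI mult_right_mono w_le)
    also have "\<dots> = ennreal (gauss_integral ?L 0) * (\<integral>\<^sup>+\<xi>. ennreal (exp (- (norm \<xi>)\<^sup>2)) \<partial>?L)"
      by (rule nn_integral_cmult) measurable
    also have "\<dots> < \<infinity>"
      using nn_integral_exp_norm_square_finite[where 'a = "real ^ 'n"] by (simp add: ennreal_mult_less_top)
    finally show ?thesis .
  qed
  interpret m: finite_measure m by (rule finite_measureI) (use m_fin in auto)
  have total: "(\<integral>\<^sup>+\<xi>. ennreal (w \<xi>) \<partial>?L) = ennreal (measure m UNIV)"
    using m.emeasure_eq_measure[of UNIV] by (simp add: m_def emeasure_density)
  have AE_m: "AE \<xi> in ?L. P \<xi>" if "AE \<xi> in m. P \<xi>" for P
  proof -
    have "AE \<xi> in ?L. 0 < ennreal (w \<xi>) \<longrightarrow> P \<xi>"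
      using that unfolding m_def by (subst (asm) AE_density) auto
    then show ?thesis by (simp add: w_pos)
  qed
  have r_borel: "r \<nu> \<in> borel_measurable m" if "\<nu> \<in> space \<mu>" for \<nu>
    using borel_measurable_continuous_onI[OF cont[OF that]] by (simp add: measurable_cong_sets[OF m_sets refl])
  have mean: "integrable m (r \<nu>)" "(\<integral>\<xi>. r \<nu> \<xi> \<partial>m) = c \<nu> * measure m (space m)"
    if \<nu>: "homogeneous \<nu>" "\<nu> \<in> growth_measures" for \<nu>
  proof -
    have [measurable]: "r \<nu> \<in> borel_measurable borel"
      using r_borel[of \<nu>] \<nu> by (simp add: space_\<mu> measurable_cong_sets[OF m_sets refl])
    have "(\<integral>\<^sup>+\<xi>. ennreal (r \<nu> \<xi>) \<partial>m) = (\<integral>\<^sup>+\<xi>. ennreal (w \<xi>) * ennreal (r \<nu> \<xi>) \<partial>?L)"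
      unfolding m_def by (rule nn_integral_density) measurable
    also have "\<dots> = (\<integral>\<^sup>+\<xi>. ennreal (exp (- (norm \<xi>)\<^sup>2) * gauss_integral \<nu> \<xi>) \<partial>?L)"
      using good_Gd[OF \<nu>]
      by (intro nn_integral_cong) (simp add: w_def r_def L_nz ennreal_mult[symmetric] gauss_integral_nonneg)
    also have "\<dots> = ball_density \<nu> * (\<integral>\<^sup>+\<xi>. ennreal (w \<xi>) \<partial>?L)"
      unfolding w_def by (rule nn_integral_gauss_mean[OF \<nu>])
    also have "\<dots> = ennreal (c \<nu> * measure m (space m))"
      using ball_density_finite[OF \<nu>(2)] c_nn[of \<nu>]
      by (simp add: total m_space c_def ennreal_mult)
    finally have *: "(\<integral>\<^sup>+\<xi>. ennreal (r \<nu> \<xi>) \<partial>m) = ennreal (c \<nu> * measure m (space m))" .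
    have **: "0 \<le> c \<nu> * measure m (space m)" using c_nn[of \<nu>] by simp
    show "integrable m (r \<nu>)"
      by (rule integrableI_nonneg) (use * r_nn in \<open>auto simp: measurable_cong_sets[OF m_sets refl]\<close>)
    show "(\<integral>\<xi>. r \<nu> \<xi> \<partial>m) = c \<nu> * measure m (space m)"
      by (rule integral_eq_nn_integral[THEN trans]) (use * ** r_nn in \<open>auto simp: measurable_cong_sets[OF m_sets refl]\<close>)
  qed
  have law: "(\<integral>\<nu>. 1 / (1 + r \<nu> \<xi>) \<partial>\<mu>) = (\<integral>\<nu>. 1 / (1 + c \<nu>) \<partial>\<mu>)" for \<xi>
  proof -
    obtain g where g: "g \<in> SL" and eq: "\<And>\<nu>. homogeneous \<nu> \<Longrightarrow> \<nu> \<in> growth_measures \<Longrightarrow>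
       gauss_integral \<nu> \<xi> = enn2real (ball_density (SL_act g \<nu>)) * gauss_integral lborel \<xi>"
      using gauss_integral_eq_ball_density[of \<xi>] by metis
    note r_meas1 [measurable]
    note gm [measurable] = measurable_SL_act[OF g]
    have "(\<integral>\<nu>. 1 / (1 + r \<nu> \<xi>) \<partial>\<mu>) = (\<integral>\<nu>. 1 / (1 + c (SL_act g \<nu>)) \<partial>\<mu>)"
    proof (rule integral_cong_AE)
      show "AE \<nu> in \<mu>. 1 / (1 + r \<nu> \<xi>) = 1 / (1 + c (SL_act g \<nu>))"
        using AE_homogeneous_growth
      proof eventually_elim
        case (elim \<nu>)
        have "r \<nu> \<xi> = c (SL_act g \<nu>)"
          using elim good_Gd[of \<nu>] eq[of \<nu>] by (simp add: r_def c_def L_nz)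
        then show ?case by simp
      qed
    qed measurable
    also have "\<dots> = (\<integral>\<nu>. 1 / (1 + c \<nu>) \<partial>distr \<mu> \<mu> (SL_act g))"
      by (rule integral_distr[symmetric]) measurable
    finally show ?thesis by (simp add: distr_SL_act[OF g])
  qed
  have phi_le: "norm (1 / (1 + t)) \<le> 1" if "t \<ge> 0" for t :: real using that by simp
  have AE_eq: "AE \<nu> in \<mu>. (\<integral>\<xi>. 1 / (1 + r \<nu> \<xi>) \<partial>m) - measure m (space m) / (1 + c \<nu>) = 0"
  proof -
    interpret pm: pair_sigma_finite \<mu> m ..
    interpret P: finite_measure "\<mu> \<Otimes>\<^sub>M m" by (rule finite_measure_pair_measure) unfold_locales
    have [measurable]: "(\<lambda>p. r (fst p) (snd p)) \<in> borel_measurable (\<mu> \<Otimes>\<^sub>M m)"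
      using r_meas by (simp add: measurable_cong_sets[OF sets_pair_measure_cong[OF refl m_sets] refl])
    have int: "integrable (\<mu> \<Otimes>\<^sub>M m) (\<lambda>(\<nu>, \<xi>). 1 / (1 + r \<nu> \<xi>))"
      unfolding case_prod_beta
      by (rule P.integrable_const_bound[where B = 1]) (use phi_le[OF r_nn] in auto)
    let ?\<Psi> = "\<lambda>\<nu>. (\<integral>\<xi>. 1 / (1 + r \<nu> \<xi>) \<partial>m) - measure m (space m) / (1 + c \<nu>)"
    have ic: "integrable \<mu> (\<lambda>\<nu>. 1 / (1 + c \<nu>))"
      by (rule integrable_const_bound[where B = 1]) (use phi_le[OF c_nn] in auto)
    have ir: "integrable \<mu> (\<lambda>\<nu>. \<integral>\<xi>. 1 / (1 + r \<nu> \<xi>) \<partial>m)"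
      using pm.integrable_fst[OF int] by simp
    have "(\<integral>\<nu>. (\<integral>\<xi>. 1 / (1 + r \<nu> \<xi>) \<partial>m) \<partial>\<mu>) = (\<integral>\<xi>. (\<integral>\<nu>. 1 / (1 + r \<nu> \<xi>) \<partial>\<mu>) \<partial>m)"
      using pm.Fubini_integral[OF int] by simp
    also have "\<dots> = measure m (space m) * (\<integral>\<nu>. 1 / (1 + c \<nu>) \<partial>\<mu>)"
      by (simp add: law)
    finally have "(\<integral>\<nu>. ?\<Psi> \<nu> \<partial>\<mu>) = 0"
      using ir integrable_mult_right[OF ic, of "measure m (space m)"]
        integral_mult_right_zero[of \<mu> "measure m (space m)" "\<lambda>\<nu>. 1 / (1 + c \<nu>)"]
      by (simp add: Bochner_Integration.integral_diff)
    moreover have "integrable \<mu> ?\<Psi>"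
      using ir integrable_mult_right[OF ic, of "measure m (space m)"] by simp
    moreover have "AE \<nu> in \<mu>. ?\<Psi> \<nu> \<ge> 0"
      using AE_homogeneous_growth
    proof eventually_elim
      case (elim \<nu>)
      then show ?case
        using m.reciprocal_Jensen_le[OF mean(1) r_nn c_nn mean(2), of \<nu>] by simp
    qed
    ultimately show ?thesis by (simp add: integral_nonneg_eq_0_iff_AE)
  qed
  show ?thesis
    using AE_eq AE_homogeneous_growth
  proof eventually_elim
    case (elim \<nu>)
    have \<nu>: "\<nu> \<in> space \<mu>" using elim by (simp add: space_\<mu>)
    have "AE \<xi> in m. r \<nu> \<xi> = c \<nu>"
      using elim by (intro m.reciprocal_Jensen_eq[OF mean(1) r_nn c_nn mean(2)]) auto
    then have "r \<nu> \<xi> = c \<nu>" for \<xi>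
      by (intro continuous_AE_lborel_eq[OF cont[OF \<nu>] continuous_on_const] AE_m)
    then show ?case
      using elim good_Gd[of \<nu>] by (simp add: r_def c_def divide_eq_eq L_nz)
  qed
qed

end

text \<open>Every such quadratic form is a square norm after a linear change of variables, which brings the
  corresponding Gaussian into the orbit of the radial one.\<close>

lemma sum_list_squares_norm:
  fixes \<xi>s :: "(real ^ 'n) list"
  obtains B :: "real ^ 'n ^ 'n"
  where "det B \<noteq> 0" "\<And>x. (norm (B *v x))\<^sup>2 = (norm x)\<^sup>2 + (\<Sum>\<xi>\<leftarrow>\<xi>s. (\<xi> \<bullet> x)\<^sup>2)"
proof -
  have "\<exists>B :: real ^ 'n ^ 'n. det B \<noteq> 0 \<and> (\<forall>x. (norm (B *v x))\<^sup>2 = (norm x)\<^sup>2 + (\<Sum>\<xi>\<leftarrow>\<xi>s. (\<xi> \<bullet> x)\<^sup>2))"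
  proof (induction \<xi>s)
    case Nil
    show ?case by (intro exI[of _ "mat 1"]) simp
  next
    case (Cons \<xi> \<xi>s)
    then obtain B :: "real ^ 'n ^ 'n" where B: "det B \<noteq> 0"
      "\<And>x. (norm (B *v x))\<^sup>2 = (norm x)\<^sup>2 + (\<Sum>\<xi>\<leftarrow>\<xi>s. (\<xi> \<bullet> x)\<^sup>2)" by auto
    obtain A :: "real ^ 'n ^ 'n" where "det A \<noteq> 0" "\<And>x. (norm (A *v x))\<^sup>2 = (norm (B *v x))\<^sup>2 + (\<xi> \<bullet> x)\<^sup>2"
      using rank_one_update_norm[OF B(1), of \<xi>] by metis
    then show ?case using B(2) by (intro exI[of _ A]) (simp add: add.commute)
  qed
  then show ?thesis using that by auto
qed

lemma nn_integral_lborel_exp_norm_linear_pos_finite: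
  fixes B :: "real ^ 'n ^ 'n"
  assumes "\<And>x. norm x \<le> norm (B *v x)"
  shows "0 < (\<integral>\<^sup>+x. ennreal (exp (- (norm (B *v x))\<^sup>2)) \<partial>lborel)"
    and "(\<integral>\<^sup>+x. ennreal (exp (- (norm (B *v x))\<^sup>2)) \<partial>lborel) < \<infinity>"
proof -
  let ?I = "\<integral>\<^sup>+x. ennreal (exp (- (norm (B *v x))\<^sup>2)) \<partial>lborel"
  have "?I \<noteq> 0"
  proof
    assume "?I = 0"
    then have "AE x in (lborel :: (real ^ 'n) measure). False"
      by (subst (asm) nn_integral_0_iff_AE) (auto simp: ennreal_eq_0_iff linorder_not_le[THEN iffD2])
    then show False by (simp add: AE_iff_null null_sets_def)
  qed
  then show "0 < ?I" by (simp add: zero_less_iff_neq_zero)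
  have "?I \<le> (\<integral>\<^sup>+x. ennreal (exp (- (norm (x :: real ^ 'n))\<^sup>2)) \<partial>lborel)"
    using assms by (intro nn_integral_mono ennreal_leI) (auto intro!: power_mono)
  then show "?I < \<infinity>" using nn_integral_exp_norm_square_finite[where 'a = "real ^ 'n"] by (rule le_less_trans)
qed

context homogeneous_siegel
begin

lemma AE_nn_integral_gauss:
  "AE \<nu> in \<mu>. \<forall>\<xi>. (\<integral>\<^sup>+x. ennreal (gauss \<xi> x) \<partial>\<nu>) = ball_density \<nu> * (\<integral>\<^sup>+x. ennreal (gauss \<xi> x) \<partial>lborel)"
  using AE_gauss_integral_eq_ball_density AE_homogeneous_growth
proof eventually_elim
  case (elim \<nu>)
  then have \<nu>: "homogeneous \<nu>" "\<nu> \<in> growth_measures" by auto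
  show ?case
  proof
    fix \<xi>
    have "(\<integral>\<^sup>+x. ennreal (gauss \<xi> x) \<partial>\<nu>) = ennreal (enn2real (ball_density \<nu>) * gauss_integral lborel \<xi>)"
      using elim by (simp add: nn_integral_gauss[OF \<nu>])
    also have "\<dots> = ball_density \<nu> * (\<integral>\<^sup>+x. ennreal (gauss \<xi> x) \<partial>lborel)"
      using ball_density_finite[OF \<nu>(2)]
      by (simp add: nn_integral_gauss[OF homogeneous_lborel lborel_growth_measures] ennreal_mult gauss_integral_nonneg)
    finally show "(\<integral>\<^sup>+x. ennreal (gauss \<xi> x) \<partial>\<nu>) = ball_density \<nu> * (\<integral>\<^sup>+x. ennreal (gauss \<xi> x) \<partial>lborel)" .
  qed
qed

text \<open>Induction on the number of squares.  A linear change of variables makes the shorter sum radial, and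
  the additional square is then treated by the two-term case for the image of \<open>\<nu>\<close>.\<close>

lemma AE_nn_integral_exp_sum_squares:
  "AE \<nu> in \<mu>. (\<integral>\<^sup>+x. ennreal (exp (- ((norm x)\<^sup>2 + (\<Sum>\<xi>\<leftarrow>\<xi>s. (\<xi> \<bullet> x)\<^sup>2)))) \<partial>\<nu>)
    = ball_density \<nu> * (\<integral>\<^sup>+x. ennreal (exp (- ((norm x)\<^sup>2 + (\<Sum>\<xi>\<leftarrow>\<xi>s. (\<xi> \<bullet> x)\<^sup>2)))) \<partial>lborel)"
proof (induction \<xi>s)
  case Nil
  show ?case using AE_nn_integral_gauss by eventually_elim (auto simp: gauss_def dest: spec[of _ 0])
next
  case (Cons \<xi> \<xi>s)
  let ?L = "lborel :: (real ^ 'n) measure"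
  obtain B :: "real ^ 'n ^ 'n" where B: "det B \<noteq> 0"
    "\<And>x. (norm (B *v x))\<^sup>2 = (norm x)\<^sup>2 + (\<Sum>\<xi>\<leftarrow>\<xi>s. (\<xi> \<bullet> x)\<^sup>2)"
    using sum_list_squares_norm[of \<xi>s] by blast
  obtain g c where g: "g \<in> SL" and c: "c > 0" and norm: "\<And>x. norm (B *v x) = c * norm (g *v x)"
    using invertible_norm_eq_scaled_SL[OF B(1)] by metis
  obtain h where h: "\<And>x. h *v (g *v x) = x" using SL_inverse[OF g] by metis
  define \<eta> where "\<eta> = (1 / c) *\<^sub>R (transpose h *v \<xi>)"
  have \<eta>: "\<eta> \<bullet> (c *\<^sub>R (g *v x)) = \<xi> \<bullet> x" for x
    using c by (simp add: \<eta>_def transpose_matrix_vector dot_lmul_matrix h)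
  have gauss_eq: "exp (- ((norm x)\<^sup>2 + (\<Sum>\<xi>\<leftarrow>\<xi> # \<xi>s. (\<xi> \<bullet> x)\<^sup>2))) = gauss \<eta> (c *\<^sub>R (g *v x))" for x
    unfolding gauss_def \<eta> using B(2)[of x] norm[of x] c by (simp add: algebra_simps)
  have scaled: "ennreal (c ^ CARD('n)) * (\<integral>\<^sup>+x. ennreal (gauss \<eta> (c *\<^sub>R (g *v x))) \<partial>\<nu>)
      = (\<integral>\<^sup>+y. ennreal (gauss \<eta> y) \<partial>SL_act g \<nu>)" if "homogeneous \<nu>" for \<nu>
  proof -
    have s: "sets \<nu> = sets borel" using that by (simp add: homogeneous_def)
    have "(\<integral>\<^sup>+y. ennreal (gauss \<eta> y) \<partial>SL_act g \<nu>)
        = ennreal (c ^ CARD('n)) * (\<integral>\<^sup>+y. ennreal (gauss \<eta> (c *\<^sub>R y)) \<partial>SL_act g \<nu>)"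
      by (rule homogeneous_nn_integral[OF homogeneous_SL_act[OF that] c]) measurable
    also have "(\<integral>\<^sup>+y. ennreal (gauss \<eta> (c *\<^sub>R y)) \<partial>SL_act g \<nu>) = (\<integral>\<^sup>+x. ennreal (gauss \<eta> (c *\<^sub>R (g *v x))) \<partial>\<nu>)"
      by (rule nn_integral_SL_act[OF s]) measurable
    finally show ?thesis ..
  qed
  let ?Z = "\<integral>\<^sup>+x. ennreal (exp (- (norm (B *v x))\<^sup>2)) \<partial>?L"
  have le: "norm x \<le> norm (B *v x)" for x
    by (rule power2_le_imp_le) (auto simp: B(2) intro!: sum_list_nonneg)
  have Z: "0 < ?Z" "?Z < \<infinity>"
    using nn_integral_lborel_exp_norm_linear_pos_finite[OF le] by auto
  show ?case
    using Cons.IH AE_homogeneous_growth AE_SL_act[OF g AE_nn_integral_gauss]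
  proof eventually_elim
    case (elim \<nu>)
    then have \<nu>: "homogeneous \<nu>" "\<nu> \<in> growth_measures" by auto
    \<comment> \<open>The shorter list evaluates the same integral with the densities of \<open>\<nu>\<close> and of its image.\<close>
    have "(\<integral>\<^sup>+x. ennreal (exp (- (norm (B *v x))\<^sup>2)) \<partial>\<nu>) = ball_density (SL_act g \<nu>) * ?Z"
      by (rule homogeneous_nn_integral_norm_linear[OF \<nu> g norm]) measurable
    moreover have "(\<integral>\<^sup>+x. ennreal (exp (- (norm (B *v x))\<^sup>2)) \<partial>\<nu>) = ball_density \<nu> * ?Z"
      using elim(1) by (simp add: B(2))
    ultimately have "ball_density (SL_act g \<nu>) * ?Z = ball_density \<nu> * ?Z" by simp
    then have bd: "ball_density (SL_act g \<nu>) = ball_density \<nu>"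
      using Z by (metis ennreal_mult_divide_eq infinity_ennreal_def less_irrefl)
    have "ennreal (c ^ CARD('n)) * (\<integral>\<^sup>+x. ennreal (gauss \<eta> (c *\<^sub>R (g *v x))) \<partial>\<nu>)
        = ball_density \<nu> * (\<integral>\<^sup>+y. ennreal (gauss \<eta> y) \<partial>SL_act g ?L)"
      using elim(3) by (simp add: scaled[OF \<nu>(1)] bd SL_act_lborel[OF g])
    also have "\<dots> = ennreal (c ^ CARD('n)) * (ball_density \<nu> * (\<integral>\<^sup>+x. ennreal (gauss \<eta> (c *\<^sub>R (g *v x))) \<partial>?L))"
      by (simp add: scaled[OF homogeneous_lborel, symmetric] mult_ac)
    finally have "(\<integral>\<^sup>+x. ennreal (gauss \<eta> (c *\<^sub>R (g *v x))) \<partial>\<nu>)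
        = ball_density \<nu> * (\<integral>\<^sup>+x. ennreal (gauss \<eta> (c *\<^sub>R (g *v x))) \<partial>?L)"
      using zero_less_power[OF c, of "CARD('n)"]
      by (simp add: ennreal_mult_cancel_left ennreal_eq_0_iff)
    then show ?case by (simp only: gauss_eq)
  qed
qed

end

section \<open>Even measures are determined by Gaussian integrals\<close>

text \<open>Polynomials approximate continuous functions uniformly on \<open>K\<close>, and these approximate the indicator
  of a compact set.\<close>

lemma finite_borel_measures_eq_on_compact_if_polynomials_eq:
  fixes M N :: "'a::euclidean_space measure"
  assumes "finite_measure M" "finite_measure N"
    and sets: "sets M = sets borel" "sets N = sets borel"
    and K: "compact K" "AE x in M. x \<in> K" "AE x in N. x \<in> K"
    and poly: "\<And>p. real_polynomial_function p \<Longrightarrow> (\<integral>x. p x \<partial>M) = (\<integral>x. p x \<partial>N)"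
    and C: "compact C"
  shows "emeasure M C = emeasure N C"
proof (cases "C = {}")
  case False
  interpret M: finite_measure M by fact
  interpret N: finite_measure N by fact
  note [measurable_cong] = sets
  have [simp]: "space M = UNIV" "space N = UNIV"
    using sets_eq_imp_space_eq[OF sets(1)] sets_eq_imp_space_eq[OF sets(2)] by auto
  have int: "integrable M f" "integrable N f" if f: "continuous_on UNIV f" for f :: "'a \<Rightarrow> real"
  proof -
    have "bounded (f ` K)"
      using K(1) f by (meson compact_continuous_image compact_imp_bounded continuous_on_subset subset_UNIV)
    then obtain B where B: "\<And>x. x \<in> K \<Longrightarrow> norm (f x) \<le> B" by (auto simp: bounded_iff)
    have [measurable]: "f \<in> borel_measurable borel" by (rule borel_measurable_continuous_onI[OF f])
    have "AE x in M. norm (f x) \<le> B" using K(2) by eventually_elim (rule B)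
    then show "integrable M f" by (rule M.integrable_const_bound) measurable
    have "AE x in N. norm (f x) \<le> B" using K(3) by eventually_elim (rule B)
    then show "integrable N f" by (rule N.integrable_const_bound) measurable
  qed
  have cont: "(\<integral>x. f x \<partial>M) = (\<integral>x. f x \<partial>N)" if f: "continuous_on UNIV f" for f :: "'a \<Rightarrow> real"
  proof (rule ccontr)
    assume ne: "(\<integral>x. f x \<partial>M) \<noteq> (\<integral>x. f x \<partial>N)"
    \<comment> \<open>The summand \<open>1\<close> keeps \<open>m\<close> positive and makes the final estimate strict.\<close>
    define m where "m = measure M UNIV + measure N UNIV + 1"
    have m: "m > 0" by (simp add: m_def add_nonneg_pos)
    define e where "e = \<bar>(\<integral>x. f x \<partial>M) - (\<integral>x. f x \<partial>N)\<bar> / m"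
    have e: "e > 0" using ne m by (simp add: e_def)
    have fK: "continuous_on K f" using f continuous_on_subset by blast
    obtain p where p: "real_polynomial_function p" "\<And>x. x \<in> K \<Longrightarrow> \<bar>f x - p x\<bar> < e"
      using Stone_Weierstrass_real_polynomial_function[OF K(1) fK e] by metis
    have pc: "continuous_on UNIV p"
      using p(1) by (simp add: continuous_on_polymonial_function real_polynomial_function_eq)
    have dM: "\<bar>(\<integral>x. f x \<partial>M) - (\<integral>x. p x \<partial>M)\<bar> \<le> e * measure M UNIV"
    proof -
      have "\<bar>(\<integral>x. f x \<partial>M) - (\<integral>x. p x \<partial>M)\<bar> = \<bar>\<integral>x. f x - p x \<partial>M\<bar>"
        using int f pc by simp
      also have "\<dots> \<le> (\<integral>x. \<bar>f x - p x\<bar> \<partial>M)" by (rule integral_abs_bound)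
      also have "\<dots> \<le> (\<integral>x. e \<partial>M)"
      proof (rule integral_mono_AE)
        show "AE x in M. \<bar>f x - p x\<bar> \<le> e" using K(2) by eventually_elim (use p(2) less_imp_le in blast)
      qed (use int f pc in auto)
      finally show ?thesis by (simp add: mult.commute)
    qed
    have dN: "\<bar>(\<integral>x. f x \<partial>N) - (\<integral>x. p x \<partial>N)\<bar> \<le> e * measure N UNIV"
    proof -
      have "\<bar>(\<integral>x. f x \<partial>N) - (\<integral>x. p x \<partial>N)\<bar> = \<bar>\<integral>x. f x - p x \<partial>N\<bar>"
        using int f pc by simp
      also have "\<dots> \<le> (\<integral>x. \<bar>f x - p x\<bar> \<partial>N)" by (rule integral_abs_bound)
      also have "\<dots> \<le> (\<integral>x. e \<partial>N)"
      proof (rule integral_mono_AE)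
        show "AE x in N. \<bar>f x - p x\<bar> \<le> e" using K(3) by eventually_elim (use p(2) less_imp_le in blast)
      qed (use int f pc in auto)
      finally show ?thesis by (simp add: mult.commute)
    qed
    have "\<bar>(\<integral>x. f x \<partial>M) - (\<integral>x. f x \<partial>N)\<bar> \<le> e * measure M UNIV + e * measure N UNIV"
      using dM dN poly[OF p(1)] by linarith
    also have "\<dots> < e * m" using e by (simp add: m_def algebra_simps)
    also have "e * m = \<bar>(\<integral>x. f x \<partial>M) - (\<integral>x. f x \<partial>N)\<bar>" using m by (simp add: e_def)
    finally show False by simp
  qed
  let ?f = "\<lambda>k x. max 0 (1 - real k * infdist x C)"
  have fc: "continuous_on UNIV (?f k)" for k by (intro continuous_intros)
  have lim: "(\<lambda>k. ?f k x) \<longlonglongrightarrow> indicat_real C x" for x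
  proof (cases "x \<in> C")
    case False
    then have "infdist x C > 0"
      using C \<open>C \<noteq> {}\<close> compact_imp_closed in_closed_iff_infdist_zero infdist_nonneg
      by (metis less_eq_real_def)
    then obtain k0 :: nat where k0: "1 < real k0 * infdist x C"
      using reals_Archimedean3 by blast
    have "?f k x = 0" if "k \<ge> k0" for k
      using k0 that mult_right_mono[of "real k0" "real k" "infdist x C"] by (simp add: infdist_nonneg)
    then have "\<forall>\<^sub>F k in sequentially. ?f k x = 0" by (auto simp: eventually_sequentially)
    then show ?thesis using False by (simp add: tendsto_eventually)
  qed simp
  have Cb: "C \<in> sets borel" using C by (simp add: borel_compact)
  have limM: "(\<lambda>k. \<integral>x. ?f k x \<partial>M) \<longlonglongrightarrow> (\<integral>x. indicat_real C x \<partial>M)"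
    by (rule integral_dominated_convergence[where w = "\<lambda>_. 1"])
       (use lim int(1)[OF fc] Cb in \<open>auto simp: infdist_nonneg sets\<close>)
  have limN: "(\<lambda>k. \<integral>x. ?f k x \<partial>N) \<longlonglongrightarrow> (\<integral>x. indicat_real C x \<partial>N)"
    by (rule integral_dominated_convergence[where w = "\<lambda>_. 1"])
       (use lim int(2)[OF fc] Cb in \<open>auto simp: infdist_nonneg sets\<close>)
  have "(\<integral>x. indicat_real C x \<partial>M) = (\<integral>x. indicat_real C x \<partial>N)"
    using LIMSEQ_unique[OF limM] limN by (simp add: cont[OF fc])
  then show ?thesis
    using Cb by (simp add: M.emeasure_eq_measure N.emeasure_eq_measure sets)
qed simp

text \<open>For compact \<open>S\<close> the sets \<open>S \<union> -S\<close> and \<open>S \<inter> -S\<close> are symmetric, and evenness gives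
  \<open>2 M(S) = M(S \<union> -S) + M(S \<inter> -S)\<close>.\<close>

lemma even_finite_measures_eqI:
  fixes M N :: "'a::euclidean_space measure"
  assumes "finite_measure M" "finite_measure N"
    and sets: "sets M = sets borel" "sets N = sets borel"
    and evenM: "\<And>S. compact S \<Longrightarrow> emeasure M (uminus ` S) = emeasure M S"
    and evenN: "\<And>S. compact S \<Longrightarrow> emeasure N (uminus ` S) = emeasure N S"
    and eq: "\<And>S. compact S \<Longrightarrow> uminus ` S = S \<Longrightarrow> emeasure M S = emeasure N S"
  shows "M = N"
proof -
  interpret M: finite_measure M by fact
  interpret N: finite_measure N by fact
  have cpt: "emeasure M S = emeasure N S" if S: "compact S" for S
  proof -
    let ?S' = "uminus ` S"
    have S': "compact ?S'" using S by (rule compact_negations)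
    have inv: "uminus ` ?S' = S" by (simp add: image_image)
    have b: "S \<in> sets borel" "?S' \<in> sets borel" using S S' by (auto intro: borel_compact)
    have un: "emeasure M (S \<union> ?S') = emeasure N (S \<union> ?S')"
      by (rule eq) (use S S' inv in \<open>auto simp: compact_Un image_Un\<close>)
    have int: "emeasure M (S \<inter> ?S') = emeasure N (S \<inter> ?S')"
    proof (rule eq)
      show "compact (S \<inter> ?S')" using S S' by (simp add: compact_Int)
      have "uminus ` (S \<inter> ?S') = ?S' \<inter> uminus ` ?S'" by (rule image_Int) simp
      then show "uminus ` (S \<inter> ?S') = S \<inter> ?S'" by (simp add: inv Int_commute)
    qed
    have two: "2 * measure L S = measure L (S \<union> ?S') + measure L (S \<inter> ?S')"
      if "finite_measure L" "sets L = sets borel" "emeasure L ?S' = emeasure L S" for L :: "'a measure"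
    proof -
      interpret L: finite_measure L by fact
      have "emeasure L S + emeasure L ?S' = emeasure L (S \<union> ?S') + emeasure L (S \<inter> ?S')"
        using b that by (intro emeasure_Un_Int) auto
      then show ?thesis
        using that(3) by (simp add: L.emeasure_eq_measure ennreal_plus[symmetric] del: ennreal_plus)
    qed
    have "measure M S = measure N S"
      using two[OF assms(1) sets(1) evenM[OF S]] two[OF assms(2) sets(2) evenN[OF S]] un int
      by (simp add: measure_def)
    then show ?thesis by (simp add: M.emeasure_eq_measure N.emeasure_eq_measure)
  qed
  have cls: "emeasure M S = emeasure N S" if S: "closed S" for S
  proof -
    let ?A = "\<lambda>n::nat. S \<inter> cball 0 (real n)"
    have un: "(\<Union>n. ?A n) = S" by (simp add: set_eq_iff real_arch_simple)
    have inc: "incseq ?A" by (intro monoI Int_mono subset_cball) simp_all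
    have sb: "range ?A \<subseteq> sets borel" using S by (intro image_subsetI) simp
    have "emeasure M S = (SUP n. emeasure M (?A n))"
      using SUP_emeasure_incseq[of ?A M] sb inc unfolding sets un by simp
    also have "\<dots> = (SUP n. emeasure N (?A n))"
      by (intro SUP_cong refl cpt closed_Int_compact S compact_cball)
    also have "\<dots> = emeasure N S"
      using SUP_emeasure_incseq[of ?A N] sb inc unfolding sets un by simp
    finally show ?thesis .
  qed
  show ?thesis
  proof (rule measure_eqI_generator_eq[where E = "Collect closed" and \<Omega> = UNIV and A = "\<lambda>_. UNIV"])
    show "sets M = sigma_sets UNIV (Collect closed)" "sets N = sigma_sets UNIV (Collect closed)"
      by (simp_all add: sets borel_eq_closed)
    show "Int_stable (Collect (closed :: 'a set \<Rightarrow> bool))" by (auto simp: Int_stable_def)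
  qed (use cls in \<open>auto simp: M.emeasure_eq_measure\<close>)
qed

definition square_exp :: "('n \<times> 'n) list \<Rightarrow> real ^ 'n \<Rightarrow> real" where
  "square_exp ps x = exp (- (\<Sum>(i, j)\<leftarrow>ps. (x $ i + x $ j)\<^sup>2))"

lemma square_exp_append: "square_exp (ps @ qs) x = square_exp ps x * square_exp qs x"
  by (simp add: square_exp_def exp_add[symmetric])

lemma square_exp_bounds: "0 < square_exp ps x" "square_exp ps x \<le> 1"
  by (auto simp: square_exp_def intro!: sum_list_nonneg)

lemma continuous_square_exp: "continuous_on UNIV (square_exp ps)"
proof (induction ps)
  case (Cons p ps)
  have "square_exp (p # ps) = (\<lambda>x. exp (- (x $ fst p + x $ snd p)\<^sup>2) * square_exp ps x)"
    by (simp add: square_exp_def fun_eq_iff exp_add[symmetric] case_prod_beta)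
  with Cons show ?case by (simp add: continuous_intros)
qed (simp add: square_exp_def[abs_def])

inductive square_exp_span :: "(real ^ 'n \<Rightarrow> real) \<Rightarrow> bool" where
  base: "square_exp_span (\<lambda>x. a * square_exp ps x)"
| add: "square_exp_span u \<Longrightarrow> square_exp_span v \<Longrightarrow> square_exp_span (\<lambda>x. u x + v x)"

lemma square_exp_span_const: "square_exp_span (\<lambda>_. a)"
  using base[of a "[]"] by (simp add: square_exp_def)

text \<open>The product of two generators is a generator again, that of the concatenated list.\<close>

lemma square_exp_span_mult:
  assumes "square_exp_span u" "square_exp_span v"
  shows "square_exp_span (\<lambda>x. u x * v x)"
  using assms(1)
proof induction
  case (base a ps)
  show ?case
    using assms(2)
  proof induction
    case (base b qs)
    show ?case
      using square_exp_span.base[of "a * b" "ps @ qs"] by (simp add: square_exp_append mult_ac)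
  next
    case (add v w)
    then show ?case using square_exp_span.add by (simp add: distrib_left)
  qed
next
  case (add u w)
  then show ?case using square_exp_span.add by (simp add: distrib_right)
qed

lemma square_exp_span_sum:
  assumes "finite I" "\<And>i. i \<in> I \<Longrightarrow> square_exp_span (u i)"
  shows "square_exp_span (\<lambda>x. \<Sum>i\<in>I. u i x)"
  using assms
  by (induction I rule: finite_induct) (auto intro: square_exp_span_const square_exp_span.add)

text \<open>An embedding of \<open>\<real>\<^sup>n / {1, -1}\<close> into a cube: pulling back polynomials gives the span of the
  Gaussians, so approximation on a compact set applies.\<close>

definition square_exp_map :: "real ^ 'n \<Rightarrow> real ^ ('n \<times> 'n)" where
  "square_exp_map x = (\<chi> p. square_exp [p] x)"

lemma continuous_square_exp_map: "continuous_on UNIV square_exp_map"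
  unfolding square_exp_map_def[abs_def] by (intro continuous_on_vec_lambda continuous_square_exp)

lemma polynomial_square_exp_map:
  assumes "real_polynomial_function p"
  shows "square_exp_span (\<lambda>x. p (square_exp_map x))"
  using assms
proof induction
  case (linear f)
  then have lin: "linear f" by (rule bounded_linear.linear)
  have "f (square_exp_map x) = (\<Sum>q\<in>UNIV. f (axis q 1) * square_exp [q] x)" for x
  proof -
    have "f (square_exp_map x) = f (\<Sum>q\<in>UNIV. square_exp_map x $ q *\<^sub>R axis q 1)"
      using basis_expansion[of "square_exp_map x"] by (simp add: scalar_mult_eq_scaleR)
    also have "\<dots> = (\<Sum>q\<in>UNIV. square_exp_map x $ q * f (axis q 1))"
      by (simp add: linear_sum[OF lin] linear_scale[OF lin])
    finally show ?thesis by (simp add: square_exp_map_def mult.commute)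
  qed
  then show ?case by (simp add: square_exp_span_sum square_exp_span.base)
qed (auto intro: square_exp_span_const square_exp_span.add square_exp_span_mult)

text \<open>The squares \<open>(x\<^sub>i + x\<^sub>j)\<^sup>2\<close> determine all products \<open>x\<^sub>i x\<^sub>j\<close>, hence \<open>x\<close> up to sign.\<close>

lemma square_exp_map_eq_iff: "square_exp_map x = square_exp_map y \<longleftrightarrow> x = y \<or> x = - y"
proof
  assume "square_exp_map x = square_exp_map y"
  then have sq: "(x $ i + x $ j)\<^sup>2 = (y $ i + y $ j)\<^sup>2" for i j
    by (auto simp: square_exp_map_def square_exp_def vec_eq_iff)
  have sqi: "(x $ i)\<^sup>2 = (y $ i)\<^sup>2" for i
    using sq[of i i] by (simp add: power2_eq_square)
  have pr: "x $ i * x $ j = y $ i * y $ j" for i j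
    using sq[of i j] sqi[of i] sqi[of j] by (simp add: power2_eq_square algebra_simps)
  show "x = y \<or> x = - y"
  proof (cases "x = 0")
    case True
    then show ?thesis using sqi by (simp add: vec_eq_iff)
  next
    case False
    then obtain k where k: "x $ k \<noteq> 0" by (auto simp: vec_eq_iff)
    have "y $ k = x $ k \<or> y $ k = - x $ k"
      using sqi[of k] by (metis minus_minus power2_eq_iff)
    then show ?thesis
    proof
      assume "y $ k = x $ k"
      then have "x $ j = y $ j" for j using pr[of k j] k by simp
      then show ?thesis by (simp add: vec_eq_iff)
    next
      assume "y $ k = - x $ k"
      then have "x $ k * x $ j = x $ k * (- y $ j)" for j using pr[of k j] by simp
      then have "x $ j = - y $ j" for j using k mult_left_cancel by metis
      then show ?thesis by (simp add: vec_eq_iff)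
    qed
  qed
next
  assume "x = y \<or> x = - y"
  moreover have "(- a - b)\<^sup>2 = (a + b)\<^sup>2" for a b :: real by (simp add: power2_eq_square algebra_simps)
  ultimately show "square_exp_map x = square_exp_map y"
    by (auto simp: square_exp_map_def square_exp_def vec_eq_iff)
qed

text \<open>The images under \<open>square_exp_map\<close> live on a cube and have the same polynomial integrals.  As the map
  identifies exactly \<open>x\<close> and \<open>-x\<close>, symmetric compact sets are full preimages of compact sets.\<close>

lemma even_finite_measures_eq_if_square_exp_eq:
  fixes M N :: "(real ^ 'n) measure"
  assumes fin: "finite_measure M" "finite_measure N"
    and sets: "sets M = sets borel" "sets N = sets borel"
    and even: "\<And>S. compact S \<Longrightarrow> emeasure M (uminus ` S) = emeasure M S"
       "\<And>S. compact S \<Longrightarrow> emeasure N (uminus ` S) = emeasure N S"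
    and eq: "\<And>ps. (\<integral>x. square_exp ps x \<partial>M) = (\<integral>x. square_exp ps x \<partial>N)"
  shows "M = N"
proof (rule even_finite_measures_eqI[OF fin sets even])
  interpret M: finite_measure M by fact
  interpret N: finite_measure N by fact
  note [measurable_cong] = sets
  have sp: "space M = UNIV" "space N = UNIV"
    using sets_eq_imp_space_eq[OF sets(1)] sets_eq_imp_space_eq[OF sets(2)] by auto
  note [measurable] = borel_measurable_continuous_onI[OF continuous_square_exp]
    borel_measurable_continuous_onI[OF continuous_square_exp_map]
  let ?T = "square_exp_map :: real ^ 'n \<Rightarrow> real ^ ('n \<times> 'n)"
  have int: "integrable M (square_exp ps)" "integrable N (square_exp ps)" for ps
  proof -
    show "integrable M (square_exp ps)"
      by (rule M.integrable_const_bound[where B = 1]) (auto simp: square_exp_bounds less_imp_le abs_of_pos)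
    show "integrable N (square_exp ps)"
      by (rule N.integrable_const_bound[where B = 1]) (auto simp: square_exp_bounds less_imp_le abs_of_pos)
  qed
  have span: "integrable M u \<and> integrable N u \<and> (\<integral>x. u x \<partial>M) = (\<integral>x. u x \<partial>N)" if "square_exp_span u" for u
    using that by induction (auto simp: int eq)
  have cube: "?T x \<in> cbox 0 1" for x
    by (simp add: mem_box_cart square_exp_map_def square_exp_bounds less_imp_le)
  fix S :: "(real ^ 'n) set" assume S: "compact S" "uminus ` S = S"
  have TS: "compact (?T ` S)"
    using S(1) continuous_square_exp_map by (meson compact_continuous_image continuous_on_subset subset_UNIV)
  have vim: "?T -` (?T ` S) = S"
  proof
    show "?T -` (?T ` S) \<subseteq> S"
    proof
      fix x assume "x \<in> ?T -` (?T ` S)"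
      then obtain y where "y \<in> S" "x = y \<or> x = - y" by (auto simp: square_exp_map_eq_iff)
      then show "x \<in> S" using S(2) by blast
    qed
  qed auto
  have "emeasure (distr M borel ?T) (?T ` S) = emeasure (distr N borel ?T) (?T ` S)"
  proof (rule finite_borel_measures_eq_on_compact_if_polynomials_eq[OF _ _ _ _ compact_cbox[of 0 1] _ _ _ TS])
    show "finite_measure (distr M borel ?T)" by (rule M.finite_measure_distr) measurable
    show "finite_measure (distr N borel ?T)" by (rule N.finite_measure_distr) measurable
    show "AE x in distr M borel ?T. x \<in> cbox 0 1" by (subst AE_distr_iff) (auto simp: cube simp del: mem_box)
    show "AE x in distr N borel ?T. x \<in> cbox 0 1" by (subst AE_distr_iff) (auto simp: cube simp del: mem_box)
    fix p :: "real ^ ('n \<times> 'n) \<Rightarrow> real" assume p: "real_polynomial_function p"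
    have "continuous_on UNIV p"
      using p by (simp add: continuous_on_polymonial_function real_polynomial_function_eq)
    then have [measurable]: "p \<in> borel_measurable borel" by (rule borel_measurable_continuous_onI)
    show "(\<integral>x. p x \<partial>distr M borel ?T) = (\<integral>x. p x \<partial>distr N borel ?T)"
      using span[OF polynomial_square_exp_map[OF p]] by (simp add: integral_distr)
  qed simp_all
  then show "emeasure M S = emeasure N S"
    using borel_compact[OF TS] by (simp add: emeasure_distr vim sp)
qed

lemma scale_measure_eq_density: "scale_measure c M = density M (\<lambda>_. c)"
  by (rule measure_eqI) (simp_all add: emeasure_density_const)

lemma nn_integral_uminus_even:
  fixes \<nu> :: "'a::euclidean_space measure"
  assumes s [measurable_cong]: "sets \<nu> = sets borel"
    and even: "\<And>E. E \<in> sets borel \<Longrightarrow> emeasure \<nu> (uminus ` E) = emeasure \<nu> E"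
    and f [measurable]: "f \<in> borel_measurable borel"
  shows "(\<integral>\<^sup>+x. f (- x) \<partial>\<nu>) = (\<integral>\<^sup>+x. f x \<partial>\<nu>)"
proof -
  have sp: "space \<nu> = UNIV" using sets_eq_imp_space_eq[OF s] by simp
  have "distr \<nu> borel uminus = \<nu>"
  proof (rule measure_eqI)
    fix E assume "E \<in> sets (distr \<nu> borel uminus)"
    then have E: "E \<in> sets borel" by simp
    have "uminus -` E = uminus ` E" by (auto simp: image_iff) (metis minus_minus)
    then show "emeasure (distr \<nu> borel uminus) E = emeasure \<nu> E"
      using E even[OF E] by (simp add: emeasure_distr sp)
  qed (simp add: s)
  then have "(\<integral>\<^sup>+x. f x \<partial>\<nu>) = (\<integral>\<^sup>+x. f x \<partial>distr \<nu> borel uminus)" by simp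
  also have "\<dots> = (\<integral>\<^sup>+x. f (- x) \<partial>\<nu>)" by (rule nn_integral_distr) measurable
  finally show ?thesis ..
qed

lemma nn_integral_lborel_uminus:
  fixes f :: "'a::euclidean_space \<Rightarrow> ennreal"
  assumes [measurable]: "f \<in> borel_measurable borel"
  shows "(\<integral>\<^sup>+x. f (- x) \<partial>lborel) = (\<integral>\<^sup>+x. f x \<partial>lborel)"
proof -
  have "(\<integral>\<^sup>+x. f x \<partial>lborel)
      = (\<integral>\<^sup>+x. f x \<partial>density (distr lborel borel (\<lambda>x::'a. 0 + (- 1) *\<^sub>R x)) (\<lambda>_. ennreal (\<bar>- 1\<bar> ^ DIM('a))))"
    by (subst lborel_affine[of "-1" 0]) auto
  then show ?thesis by (simp add: nn_integral_density nn_integral_distr)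
qed

text \<open>The weight \<open>exp(- |x|\<^sup>2)\<close> makes both measures finite, and it can be divided out again because it
  has no zeros.\<close>

lemma even_measures_eq_if_gaussian_integrals_eq:
  fixes M N :: "(real ^ 'n) measure"
  assumes sets: "sets M = sets borel" "sets N = sets borel"
    and even: "\<And>f. f \<in> borel_measurable borel \<Longrightarrow> (\<integral>\<^sup>+x. f (- x) \<partial>M) = (\<integral>\<^sup>+x. f x \<partial>M)"
      "\<And>f. f \<in> borel_measurable borel \<Longrightarrow> (\<integral>\<^sup>+x. f (- x) \<partial>N) = (\<integral>\<^sup>+x. f x \<partial>N)"
    and fin: "(\<integral>\<^sup>+x. ennreal (exp (- (norm x)\<^sup>2)) \<partial>N) < \<infinity>"
    and eq: "\<And>ps. (\<integral>\<^sup>+x. ennreal (exp (- (norm x)\<^sup>2) * square_exp ps x) \<partial>M)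
      = (\<integral>\<^sup>+x. ennreal (exp (- (norm x)\<^sup>2) * square_exp ps x) \<partial>N)"
  shows "M = N"
proof -
  note [measurable_cong] = sets
  note [measurable] = borel_measurable_continuous_onI[OF continuous_square_exp]
  let ?w = "\<lambda>x :: real ^ 'n. ennreal (exp (- (norm x)\<^sup>2))"
  have finM: "(\<integral>\<^sup>+x. ?w x \<partial>M) < \<infinity>"
    using eq[of "[]"] fin by (simp add: square_exp_def)
  have fm: "finite_measure (density L ?w)"
    if [measurable_cong]: "sets L = sets borel" and "(\<integral>\<^sup>+x. ?w x \<partial>L) < \<infinity>" for L
  proof (rule finite_measureI)
    show "emeasure (density L ?w) (space (density L ?w)) \<noteq> \<infinity>"
      using that(2) by (simp add: emeasure_density cong: nn_integral_cong)
  qed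
  have ev: "emeasure (density L ?w) (uminus ` S) = emeasure (density L ?w) S"
    if [measurable_cong]: "sets L = sets borel" and "compact S"
      and L: "\<And>f. f \<in> borel_measurable borel \<Longrightarrow> (\<integral>\<^sup>+x. f (- x) \<partial>L) = (\<integral>\<^sup>+x. f x \<partial>L)" for L S
  proof -
    have [measurable]: "S \<in> sets borel" "uminus ` S \<in> sets borel"
      using \<open>compact S\<close> by (auto intro!: borel_compact compact_negations)
    have "emeasure (density L ?w) (uminus ` S) = (\<integral>\<^sup>+x. ?w x * indicator (uminus ` S) x \<partial>L)"
      by (rule emeasure_density) measurable
    also have "\<dots> = (\<integral>\<^sup>+x. ?w (- x) * indicator (uminus ` S) (- x) \<partial>L)"
      by (rule L[symmetric]) measurable
    also have "\<dots> = (\<integral>\<^sup>+x. ?w x * indicator S x \<partial>L)"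
      by (rule nn_integral_cong) (auto simp: indicator_def)
    also have "\<dots> = emeasure (density L ?w) S"
      by (rule emeasure_density[symmetric]) measurable
    finally show ?thesis .
  qed
  have se: "ennreal (\<integral>x. square_exp ps x \<partial>density L ?w) = (\<integral>\<^sup>+x. ennreal (exp (- (norm x)\<^sup>2) * square_exp ps x) \<partial>L)"
    if s [measurable_cong]: "sets L = sets borel" and f: "(\<integral>\<^sup>+x. ?w x \<partial>L) < \<infinity>" for L ps
  proof -
    interpret finite_measure "density L ?w" by (rule fm[OF s f])
    have "ennreal (\<integral>x. square_exp ps x \<partial>density L ?w) = (\<integral>\<^sup>+x. ennreal (square_exp ps x) \<partial>density L ?w)"
      by (rule nn_integral_eq_integral[symmetric], rule integrable_const_bound[where B = 1])
         (auto simp: square_exp_bounds less_imp_le abs_of_pos)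
    also have "\<dots> = (\<integral>\<^sup>+x. ?w x * ennreal (square_exp ps x) \<partial>L)"
      by (rule nn_integral_density) measurable
    finally show ?thesis by (simp add: ennreal_mult square_exp_bounds less_imp_le)
  qed
  have nn: "0 \<le> (\<integral>x. square_exp ps x \<partial>density L ?w)" for ps L
    by (rule integral_nonneg_AE) (simp add: square_exp_bounds less_imp_le)
  have "density M ?w = density N ?w"
  proof (rule even_finite_measures_eq_if_square_exp_eq)
    show "finite_measure (density M ?w)" by (rule fm[OF sets(1) finM])
    show "finite_measure (density N ?w)" by (rule fm[OF sets(2) fin])
    show "emeasure (density M ?w) (uminus ` S) = emeasure (density M ?w) S" if "compact S" for S
      by (rule ev[OF sets(1) that even(1)])
    show "emeasure (density N ?w) (uminus ` S) = emeasure (density N ?w) S" if "compact S" for S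
      by (rule ev[OF sets(2) that even(2)])
    fix ps
    have "ennreal (\<integral>x. square_exp ps x \<partial>density M ?w) = ennreal (\<integral>x. square_exp ps x \<partial>density N ?w)"
      unfolding se[OF sets(1) finM] se[OF sets(2) fin] by (rule eq)
    then show "(\<integral>x. square_exp ps x \<partial>density M ?w) = (\<integral>x. square_exp ps x \<partial>density N ?w)"
      using nn by (simp only: ennreal_inj)
  qed (simp_all add: sets)
  then have "density (density M ?w) (\<lambda>x. ennreal (exp ((norm x)\<^sup>2))) = density (density N ?w) (\<lambda>x. ennreal (exp ((norm x)\<^sup>2)))"
    by simp
  moreover have "density (density L ?w) (\<lambda>x. ennreal (exp ((norm x)\<^sup>2))) = L"
    if [measurable_cong]: "sets L = sets borel" for L
    by (subst density_density_eq) (auto simp: ennreal_mult[symmetric] exp_add[symmetric] density_1)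
  ultimately show ?thesis using sets by simp
qed


section \<open>Ergodicity and the value of the constant\<close>

lemma (in homogeneous_siegel) AE_eq_scale_lborel:
  assumes even: "AE \<nu> in \<mu>. \<nu> \<in> even_growth_measures"
  shows "AE \<nu> in \<mu>. \<nu> = scale_measure (ball_density \<nu>) lborel"
proof -
  let ?L = "lborel :: (real ^ 'n) measure"
  let ?\<xi>s = "\<lambda>ps :: ('n \<times> 'n) list. map (\<lambda>(i, j). axis i 1 + axis j (1 :: real)) ps"
  have eq: "exp (- ((norm x)\<^sup>2 + (\<Sum>\<xi>\<leftarrow>?\<xi>s ps. (\<xi> \<bullet> x)\<^sup>2))) = exp (- (norm x)\<^sup>2) * square_exp ps x" for x ps
    by (simp add: square_exp_def exp_add[symmetric] comp_def case_prod_unfold inner_add_left inner_axis')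
  have "AE \<nu> in \<mu>. \<forall>ps. (\<integral>\<^sup>+x. ennreal (exp (- (norm x)\<^sup>2) * square_exp ps x) \<partial>\<nu>)
    = ball_density \<nu> * (\<integral>\<^sup>+x. ennreal (exp (- (norm x)\<^sup>2) * square_exp ps x) \<partial>?L)"
    using AE_nn_integral_exp_sum_squares[of "?\<xi>s _"] unfolding eq by (simp add: AE_all_countable)
  then show ?thesis
    using even AE_homogeneous_growth
  proof eventually_elim
    case (elim \<nu>)
    then have \<nu>: "homogeneous \<nu>" "\<nu> \<in> growth_measures" by auto
    have s: "sets \<nu> = sets borel" by (rule growth_measures_sets[OF \<nu>(2)])
    note [measurable] = borel_measurable_continuous_onI[OF continuous_square_exp]
    show "\<nu> = scale_measure (ball_density \<nu>) ?L"
    proof (rule even_measures_eq_if_gaussian_integrals_eq[OF s])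
      show "(\<integral>\<^sup>+x. ennreal (exp (- (norm x)\<^sup>2)) \<partial>scale_measure (ball_density \<nu>) ?L) < \<infinity>"
        using ball_density_finite[OF \<nu>(2)] nn_integral_exp_norm_square_finite[where 'a = "real ^ 'n"]
        by (subst nn_integral_scale_measure) (simp_all add: ennreal_mult_less_top)
      show "(\<integral>\<^sup>+x. f (- x) \<partial>\<nu>) = (\<integral>\<^sup>+x. f x \<partial>\<nu>)" if "f \<in> borel_measurable borel" for f
        by (rule nn_integral_uminus_even[OF s _ that]) (use elim in \<open>auto simp: even_growth_measures_def\<close>)
      show "(\<integral>\<^sup>+x. f (- x) \<partial>scale_measure (ball_density \<nu>) ?L) = (\<integral>\<^sup>+x. f x \<partial>scale_measure (ball_density \<nu>) ?L)"
        if [measurable]: "f \<in> borel_measurable borel" for f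
        by (simp add: nn_integral_scale_measure nn_integral_lborel_uminus)
      show "(\<integral>\<^sup>+x. ennreal (exp (- (norm x)\<^sup>2) * square_exp ps x) \<partial>\<nu>)
          = (\<integral>\<^sup>+x. ennreal (exp (- (norm x)\<^sup>2) * square_exp ps x) \<partial>scale_measure (ball_density \<nu>) ?L)" for ps
        using elim by (simp add: nn_integral_scale_measure)
    qed simp
  qed
qed

text \<open>The constant is the infimum of the \<open>a\<close> for which \<open>t \<le> a\<close> almost everywhere.\<close>

lemma (in prob_space) AE_const_if_zero_one_cdf:
  fixes t :: "'a \<Rightarrow> real"
  assumes nonneg: "\<And>x. 0 \<le> t x"
    and zero_one: "\<And>a. (AE x in M. t x \<le> a) \<or> (AE x in M. a < t x)"
  obtains c where "c \<ge> 0" "AE x in M. t x = c"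
proof -
  define S where "S = {a. AE x in M. t x \<le> a}"
  have "S \<noteq> {}"
  proof
    assume "S = {}"
    then have "AE x in M. real n < t x" for n using zero_one[of "real n"] by (auto simp: S_def)
    then have "AE x in M. \<forall>n. real n < t x" by (simp add: AE_all_countable)
    then have "AE x in M. False" by eventually_elim (meson less_asym' reals_Archimedean2)
    then show False by (simp add: AE_False)
  qed
  have S_nn: "0 \<le> a" if "a \<in> S" for a
  proof (rule ccontr)
    assume "\<not> 0 \<le> a"
    then have neg: "a < 0" by simp
    have "AE x in M. t x \<le> a" using that by (simp add: S_def)
    then have "AE x in M. False"
    proof eventually_elim
      case (elim x)
      then show ?case using nonneg[of x] neg by simp
    qed
    then show False by (simp add: AE_False)
  qed
  define c where "c = Inf S"
  have bdd: "bdd_below S" by (rule bdd_belowI[of S 0]) (rule S_nn)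
  have upper: "AE x in M. t x \<le> c + 1 / real (Suc n)" for n
  proof -
    have "Inf S < c + 1 / real (Suc n)" by (simp add: c_def)
    then obtain a where a: "a \<in> S" "a < c + 1 / real (Suc n)"
      using \<open>S \<noteq> {}\<close> by (rule cInf_lessD[rotated, THEN bexE]) auto
    then show ?thesis by (auto simp: S_def elim!: eventually_mono)
  qed
  have lower: "AE x in M. c - 1 / real (Suc n) < t x" for n
  proof -
    have "c - 1 / real (Suc n) \<notin> S"
      using cInf_lower[OF _ bdd, of "c - 1 / real (Suc n)"] by (auto simp: c_def[symmetric])
    then show ?thesis using zero_one[of "c - 1 / real (Suc n)"] by (auto simp: S_def)
  qed
  have "AE x in M. \<forall>n. c - 1 / real (Suc n) < t x \<and> t x \<le> c + 1 / real (Suc n)"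
    unfolding AE_all_countable using upper lower by (auto intro: AE_conjI)
  then have "AE x in M. t x = c"
  proof eventually_elim
    case (elim x)
    show ?case
    proof (rule ccontr)
      assume "t x \<noteq> c"
      then obtain n where "1 / real (Suc n) < \<bar>t x - c\<bar>"
        using reals_Archimedean[of "\<bar>t x - c\<bar>"] by (auto simp: inverse_eq_divide)
      then show False using elim[rule_format, of n] by (auto simp: abs_if split: if_splits)
    qed
  qed
  moreover have "c \<ge> 0" unfolding c_def using \<open>S \<noteq> {}\<close> S_nn by (rule cInf_greatest)
  ultimately show ?thesis using that by blast
qed

lemma integral_scale_measure_ennreal:
  fixes f :: "'a \<Rightarrow> real"
  assumes "f \<in> borel_measurable M" "c \<ge> 0"
  shows "(\<integral>x. f x \<partial>scale_measure (ennreal c) M) = c * (\<integral>x. f x \<partial>M)"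
  unfolding scale_measure_eq_density using assms by (subst integral_density) auto

lemma exists_normalized_compactly_supported_continuous:
  obtains \<psi> :: "real ^ 'n \<Rightarrow> real"
  where "\<psi> \<in> compactly_supported_continuous" "(\<integral>x. \<psi> x \<partial>lborel) = 1"
proof -
  let ?f = "\<lambda>x :: real ^ 'n. max 0 (1 - norm x)"
  have cont: "continuous_on UNIV ?f" by (intro continuous_intros)
  have "{x. ?f x \<noteq> 0} \<subseteq> ball 0 1" by auto
  then have supp: "compact (closure {x. ?f x \<noteq> 0})"
    unfolding compact_closure by (rule bounded_subset[OF bounded_ball])
  have f: "?f \<in> compactly_supported_continuous"
    using cont supp by (simp add: compactly_supported_continuous_def)
  have int: "integrable lborel ?f"
    by (rule compactly_supported_continuous_integrable[OF lborel_growth_measures f])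
  define I where "I = (\<integral>x. ?f x \<partial>lborel)"
  have "I \<noteq> 0"
  proof
    assume "I = 0"
    then have "AE x in lborel. ?f x = 0"
      using integral_nonneg_eq_0_iff_AE[OF int] by (simp add: I_def)
    then have "?f 0 = 0"
      by (rule continuous_AE_lborel_eq[OF cont continuous_on_const])
    then show False by simp
  qed
  show ?thesis
  proof
    have "{x. ?f x / I \<noteq> 0} = {x. ?f x \<noteq> 0}" using \<open>I \<noteq> 0\<close> by simp
    then show "(\<lambda>x. ?f x / I) \<in> compactly_supported_continuous"
      using supp \<open>I \<noteq> 0\<close> unfolding compactly_supported_continuous_def
      by (auto intro!: continuous_intros)
    show "(\<integral>x. ?f x / I \<partial>lborel) = 1" using \<open>I \<noteq> 0\<close> by (simp add: I_def)
  qed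
qed

lemma compactly_supported_continuous_borel_measurable:
  "\<psi> \<in> compactly_supported_continuous \<Longrightarrow> \<psi> \<in> borel_measurable borel"
  by (auto simp: compactly_supported_continuous_def intro: borel_measurable_continuous_onI)

lemma compactly_supported_continuous_diff:
  assumes "\<psi> \<in> compactly_supported_continuous" "\<phi> \<in> compactly_supported_continuous"
  shows "(\<lambda>x. \<psi> x - k * \<phi> x) \<in> compactly_supported_continuous"
proof -
  have "{x. \<psi> x - k * \<phi> x \<noteq> 0} \<subseteq> {x. \<psi> x \<noteq> 0} \<union> {x. \<phi> x \<noteq> 0}" by auto
  moreover have "bounded ({x. \<psi> x \<noteq> 0} \<union> {x. \<phi> x \<noteq> 0})"
    using assms by (simp add: compactly_supported_continuous_def compact_closure)
  ultimately have "compact (closure {x. \<psi> x - k * \<phi> x \<noteq> 0})"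
    unfolding compact_closure by (rule bounded_subset[rotated])
  then show ?thesis
    using assms by (auto simp: compactly_supported_continuous_def intro!: continuous_intros)
qed

lemma compactly_supported_continuous_SL:
  fixes \<psi> :: "real ^ 'n \<Rightarrow> real"
  assumes \<psi>: "\<psi> \<in> compactly_supported_continuous" and g: "g \<in> SL"
  shows "(\<lambda>x. \<psi> (g *v x)) \<in> compactly_supported_continuous"
proof -
  obtain h where h: "\<And>x. h *v (g *v x) = x" using SL_inverse[OF g] by metis
  have c: "continuous_on UNIV \<psi>" using \<psi> by (simp add: compactly_supported_continuous_def)
  have "{x. \<psi> (g *v x) \<noteq> 0} \<subseteq> (*v) h ` {x. \<psi> x \<noteq> 0}"
    using h by (auto simp: image_iff) metis
  moreover have "bounded ((*v) h ` {x. \<psi> x \<noteq> 0})"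
    using \<psi> by (intro bounded_linear_image) (simp_all add: compactly_supported_continuous_def compact_closure)
  ultimately have "compact (closure {x. \<psi> (g *v x) \<noteq> 0})"
    unfolding compact_closure by (rule bounded_subset[rotated])
  moreover have "continuous_on UNIV (\<lambda>x. \<psi> (g *v x))"
    by (rule continuous_on_compose2[OF c matrix_vector_mult_linear_continuous_on]) simp
  ultimately show ?thesis by (simp add: compactly_supported_continuous_def)
qed

lemma integral_SL_act:
  fixes \<psi> :: "real ^ 'n \<Rightarrow> real"
  assumes [measurable_cong]: "sets \<nu> = sets borel" and [measurable]: "\<psi> \<in> borel_measurable borel"
  shows "(\<integral>x. \<psi> x \<partial>SL_act g \<nu>) = (\<integral>x. \<psi> (g *v x) \<partial>\<nu>)"
  unfolding SL_act_def by (rule integral_distr) measurable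

text \<open>For \<open>\<phi>\<close> with Lebesgue integral \<open>1\<close> these are the multiples \<open>t dx\<close> with \<open>t \<le> a\<close>, described by
  continuous test functions so that the set is visibly closed.\<close>

definition lebesgue_multiples :: "(real ^ 'n \<Rightarrow> real) \<Rightarrow> real \<Rightarrow> (real ^ 'n) measure set" where
  "lebesgue_multiples \<phi> a = {\<nu> \<in> growth_measures. (\<integral>x. \<phi> x \<partial>\<nu>) \<le> a \<and>
     (\<forall>\<psi>\<in>compactly_supported_continuous. (\<integral>x. \<psi> x \<partial>\<nu>) = (\<integral>x. \<psi> x \<partial>lborel) * (\<integral>x. \<phi> x \<partial>\<nu>))}"

text \<open>The complement is a union of subbasic open sets; the union over \<open>\<psi>\<close> is uncountable, so openness
  and not just measurability of the single sets is used.\<close>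

lemma lebesgue_multiples_measurable:
  fixes \<phi> :: "real ^ 'n \<Rightarrow> real"
  assumes \<phi>: "\<phi> \<in> compactly_supported_continuous"
  shows "lebesgue_multiples \<phi> a \<in> sets growth_measures_borel"
proof -
  let ?G = "growth_measures :: (real ^ 'n) measure set"
  let ?\<psi>s = "compactly_supported_continuous :: (real ^ 'n \<Rightarrow> real) set"
  let ?O = "{\<nu> \<in> ?G. (\<integral>x. \<phi> x \<partial>\<nu>) \<in> {a<..}} \<union>
    (\<Union>\<psi>\<in>?\<psi>s. {\<nu> \<in> ?G. (\<integral>x. \<psi> x - (\<integral>x. \<psi> x \<partial>lborel) * \<phi> x \<partial>\<nu>) \<in> - {0}})"
  have "openin weak_star_topology {\<nu> \<in> ?G. (\<integral>x. \<psi> x - (\<integral>x. \<psi> x \<partial>lborel) * \<phi> x \<partial>\<nu>) \<in> - {0}}"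
    if "\<psi> \<in> ?\<psi>s" for \<psi>
    by (rule openin_weak_star_topology[OF compactly_supported_continuous_diff[OF that \<phi>]]) (simp add: open_Compl)
  then have "openin weak_star_topology ?O"
    by (intro openin_Un[OF openin_weak_star_topology[OF \<phi>] openin_Union]) auto
  then have O: "?O \<in> sets growth_measures_borel"
    unfolding sets_growth_measures_borel by (intro sigma_sets.Basic) simp
  have diff: "(\<integral>x. \<psi> x - k * \<phi> x \<partial>\<nu>) = (\<integral>x. \<psi> x \<partial>\<nu>) - k * (\<integral>x. \<phi> x \<partial>\<nu>)"
    if "\<nu> \<in> ?G" "\<psi> \<in> ?\<psi>s" for \<nu> \<psi> k
    using that compactly_supported_continuous_integrable[OF that(1)] \<phi> by simp
  have "lebesgue_multiples \<phi> a = space growth_measures_borel - ?O"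
    unfolding lebesgue_multiples_def space_growth_measures_borel by (auto simp: diff not_less)
  then show ?thesis using sets.compl_sets[OF O] by (simp only:)
qed

lemma lebesgue_multiples_SL_act:
  assumes \<phi>: "\<phi> \<in> compactly_supported_continuous" "(\<integral>x. \<phi> x \<partial>lborel) = 1"
    and g: "g \<in> SL" and \<nu>: "\<nu> \<in> lebesgue_multiples \<phi> a"
  shows "SL_act g \<nu> \<in> lebesgue_multiples \<phi> a"
proof -
  have gr: "\<nu> \<in> growth_measures" using \<nu> by (simp add: lebesgue_multiples_def)
  have int: "(\<integral>x. \<psi> x \<partial>SL_act g \<nu>) = (\<integral>x. \<psi> x \<partial>lborel) * (\<integral>x. \<phi> x \<partial>\<nu>)"
    if \<psi>: "\<psi> \<in> compactly_supported_continuous" for \<psi>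
  proof -
    have "(\<integral>x. \<psi> x \<partial>SL_act g \<nu>) = (\<integral>x. \<psi> (g *v x) \<partial>\<nu>)"
      by (rule integral_SL_act[OF growth_measures_sets[OF gr] compactly_supported_continuous_borel_measurable[OF \<psi>]])
    also have "\<dots> = (\<integral>x. \<psi> (g *v x) \<partial>lborel) * (\<integral>x. \<phi> x \<partial>\<nu>)"
      using \<nu> compactly_supported_continuous_SL[OF \<psi> g] by (simp add: lebesgue_multiples_def)
    also have "(\<integral>x. \<psi> (g *v x) \<partial>lborel) = (\<integral>x. \<psi> x \<partial>SL_act g lborel)"
      by (rule integral_SL_act[symmetric]) (simp_all add: compactly_supported_continuous_borel_measurable[OF \<psi>])
    finally show ?thesis by (simp add: SL_act_lborel[OF g])
  qed
  have "(\<integral>x. \<phi> x \<partial>SL_act g \<nu>) = (\<integral>x. \<phi> x \<partial>\<nu>)" using int[OF \<phi>(1)] \<phi>(2) by simp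
  with \<nu> int SL_act_growth_measures[OF gr g] show ?thesis
    by (simp add: lebesgue_multiples_def)
qed

lemma lebesgue_multiples_SL_invariant:
  assumes \<phi>: "\<phi> \<in> compactly_supported_continuous" "(\<integral>x. \<phi> x \<partial>lborel) = 1" and g: "g \<in> SL"
  shows "SL_act g -` lebesgue_multiples \<phi> a \<inter> growth_measures = lebesgue_multiples \<phi> a"
proof (intro set_eqI iffI)
  fix \<nu> assume "\<nu> \<in> SL_act g -` lebesgue_multiples \<phi> a \<inter> growth_measures"
  then have \<nu>: "SL_act g \<nu> \<in> lebesgue_multiples \<phi> a" "\<nu> \<in> growth_measures" by auto
  note s [measurable_cong] = growth_measures_sets[OF \<nu>(2)]
  obtain h where h: "h \<in> SL" "\<And>x. h *v (g *v x) = x" using SL_inverse[OF g] by metis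
  have "SL_act h (SL_act g \<nu>) = distr \<nu> borel (\<lambda>x. x)"
    unfolding SL_act_def by (subst distr_distr) (simp_all add: comp_def h(2))
  also have "\<dots> = \<nu>" using s by (simp add: distr_id2)
  finally show "\<nu> \<in> lebesgue_multiples \<phi> a"
    using lebesgue_multiples_SL_act[OF \<phi> h(1) \<nu>(1)] by simp
next
  fix \<nu> assume "\<nu> \<in> lebesgue_multiples \<phi> a"
  then show "\<nu> \<in> SL_act g -` lebesgue_multiples \<phi> a \<inter> growth_measures"
    using lebesgue_multiples_SL_act[OF \<phi> g] by (auto simp: lebesgue_multiples_def)
qed

lemma (in homogeneous_siegel) AE_eq_const_scale_lborel:
  assumes even: "AE \<nu> in \<mu>. \<nu> \<in> even_growth_measures"
  obtains c where "c \<ge> 0" "AE \<nu> in \<mu>. \<nu> = scale_measure (ennreal c) lborel"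
proof -
  let ?L = "lborel :: (real ^ 'n) measure"
  obtain \<phi> :: "real ^ 'n \<Rightarrow> real" where \<phi>: "\<phi> \<in> compactly_supported_continuous" "(\<integral>x. \<phi> x \<partial>lborel) = 1"
    by (rule exists_normalized_compactly_supported_continuous)
  define t where "t \<nu> = enn2real (ball_density \<nu>)" for \<nu> :: "(real ^ 'n) measure"
  have eq: "AE \<nu> in \<mu>. \<nu> \<in> growth_measures \<and> \<nu> = scale_measure (ennreal (t \<nu>)) ?L"
    using AE_eq_scale_lborel[OF even] AE_homogeneous_growth
    by eventually_elim (auto simp: t_def ball_density_finite[unfolded infinity_ennreal_def])
  have mem: "AE \<nu> in \<mu>. \<nu> \<in> lebesgue_multiples \<phi> a \<longleftrightarrow> t \<nu> \<le> a" for a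
    using eq
  proof eventually_elim
    case (elim \<nu>)
    have int: "(\<integral>x. \<psi> x \<partial>\<nu>) = t \<nu> * (\<integral>x. \<psi> x \<partial>?L)" if "\<psi> \<in> compactly_supported_continuous" for \<psi>
      using elim integral_scale_measure_ennreal[of \<psi> ?L "t \<nu>"]
        compactly_supported_continuous_borel_measurable[OF that] by (simp add: t_def)
    show ?case using elim by (auto simp: lebesgue_multiples_def int \<phi>)
  qed
  have zo: "(AE \<nu> in \<mu>. t \<nu> \<le> a) \<or> (AE \<nu> in \<mu>. a < t \<nu>)" for a
  proof -
    let ?A = "lebesgue_multiples \<phi> a"
    have A: "?A \<in> sets \<mu>" using lebesgue_multiples_measurable[OF \<phi>(1)] by (simp add: sets_\<mu>)
    have "\<forall>g\<in>SL. SL_act g -` ?A \<inter> space \<mu> = ?A"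
      using lebesgue_multiples_SL_invariant[OF \<phi>] by (simp add: space_\<mu>)
    then have "emeasure \<mu> ?A = 0 \<or> emeasure \<mu> ?A = 1"
      using A siegel by (auto simp: siegel_measure_def)
    then show ?thesis
    proof
      assume "emeasure \<mu> ?A = 0"
      then have "AE \<nu> in \<mu>. \<nu> \<notin> ?A" using A by (intro AE_not_in null_setsI)
      then have "AE \<nu> in \<mu>. a < t \<nu>" using mem[of a] by eventually_elim auto
      then show ?thesis ..
    next
      assume "emeasure \<mu> ?A = 1"
      then have "AE \<nu> in \<mu>. \<nu> \<in> ?A" using A by (simp add: AE_in_set_eq_1 measure_def)
      then have "AE \<nu> in \<mu>. t \<nu> \<le> a" using mem[of a] by eventually_elim auto
      then show ?thesis ..
    qed
  qed
  obtain c where c: "c \<ge> 0" "AE \<nu> in \<mu>. t \<nu> = c"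
    using AE_const_if_zero_one_cdf[of t, OF _ zo] by (auto simp: t_def)
  have "AE \<nu> in \<mu>. \<nu> = scale_measure (ennreal c) ?L"
    using c(2) eq by eventually_elim auto
  then show ?thesis using c(1) that by blast
qed

lemma (in homogeneous_siegel) siegel_constant_eq:
  assumes c: "c \<ge> 0" and eq: "AE \<nu> in \<mu>. \<nu> = scale_measure (ennreal c) lborel"
  shows "siegel_constant \<mu> = c"
proof -
  let ?L = "lborel :: (real ^ 'n) measure"
  have formula: "siegel_formula \<mu> c"
    unfolding siegel_formula_def
  proof (intro ballI impI conjI)
    fix \<psi> :: "real ^ 'n \<Rightarrow> real" assume \<psi>: "\<psi> \<in> borel_measurable borel" "integrable lborel \<psi>"
    have int: "integrable (scale_measure (ennreal c) ?L) \<psi>"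
      unfolding scale_measure_eq_density using \<psi> c by (subst integrable_density) auto
    show "AE \<nu> in \<mu>. integrable \<nu> \<psi>" using eq by eventually_elim (simp add: int)
    have m: "(\<lambda>\<nu>. \<integral>x. \<psi> x \<partial>\<nu>) \<in> borel_measurable \<mu>"
      by (intro measurable_\<mu>I measurable_integral_growth_measures \<psi>)
    have ae: "AE \<nu> in \<mu>. (\<integral>x. \<psi> x \<partial>\<nu>) = c * (\<integral>x. \<psi> x \<partial>?L)"
      using eq by eventually_elim (use integral_scale_measure_ennreal[of \<psi> ?L c] \<psi> c in simp)
    have "has_bochner_integral \<mu> (\<lambda>_. c * (\<integral>x. \<psi> x \<partial>?L)) (c * (\<integral>x. \<psi> x \<partial>?L))"
      by (simp add: has_bochner_integral_iff prob_space)
    then show "has_bochner_integral \<mu> (\<lambda>\<nu>. \<integral>x. \<psi> x \<partial>\<nu>) (c * (\<integral>x. \<psi> x \<partial>?L))"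
      using has_bochner_integral_cong_AE[OF m _ ae, of "c * (\<integral>x. \<psi> x \<partial>?L)"] by simp
  qed
  show ?thesis
    unfolding siegel_constant_def
    by (rule the_equality[where P = "siegel_formula \<mu>", OF formula siegel_formula_unique[OF _ formula]])
qed

theorem theorem8p7:
  fixes \<mu> :: "(real ^ 'n) measure measure"
  assumes "CARD('n) > 1"
    and "siegel_measure \<mu>"
    and "AE \<nu> in \<mu>. \<nu> \<in> even_growth_measures"
    and "AE \<nu> in \<mu>. \<forall>r>0. dilate r \<nu> = \<nu>"
  shows "\<mu> = return growth_measures_borel
                (scale_measure (ennreal (siegel_constant \<mu>)) lborel)"
proof -
  have "AE \<nu> in \<mu>. homogeneous \<nu>"
    using assms(3,4)
    by eventually_elim (auto simp: homogeneous_def even_growth_measures_def growth_measures_sets)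
  then interpret homogeneous_siegel \<mu> using assms(2) by unfold_locales
  obtain c where c: "c \<ge> 0" "AE \<nu> in \<mu>. \<nu> = scale_measure (ennreal c) lborel"
    by (rule AE_eq_const_scale_lborel[OF assms(3)])
  let ?\<nu> = "scale_measure (ennreal c) (lborel :: (real ^ 'n) measure)"
  have "\<mu> = return growth_measures_borel ?\<nu>"
  proof (rule measure_eqI)
    fix A assume A: "A \<in> sets \<mu>"
    show "emeasure \<mu> A = emeasure (return growth_measures_borel ?\<nu>) A"
    proof (cases "?\<nu> \<in> A")
      case True
      have "AE \<nu> in \<mu>. \<nu> \<in> A" using c(2) by eventually_elim (use True in simp)
      then have "emeasure \<mu> A = 1" using A by (simp add: emeasure_eq_1_AE)
      then show ?thesis using True A by (simp add: sets_\<mu>)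
    next
      case False
      have "AE \<nu> in \<mu>. \<nu> \<notin> A" using c(2) by eventually_elim (use False in simp)
      then have "emeasure \<mu> A = 0" using A AE_iff_null_sets by blast
      then show ?thesis using False A by (simp add: sets_\<mu>)
    qed
  qed (simp add: sets_\<mu>)
  then show ?thesis unfolding siegel_constant_eq[OF c] .
qed

end
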